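(* Let $a,b,c,d\in\mathbb{R}$ with $a^2+c^2\neq0$, $b^2+d^2\neq0$ and $ad-bc\neq0$, and let $\mathfrak{g}_{a,b,c,d}$ be the $7$-dimensional real Lie algebra with basis $\{e_1,\ldots,e_7\}$ and nonzero brackets $$[e_1,e_4]=ae_5,\ [e_1,e_5]=-ae_4,\ [e_1,e_6]=be_7,\ [e_1,e_7]=-be_6,$$ $$[e_2,e_4]=ce_5,\ [e_2,e_5]=-ce_4,\ [e_2,e_6]=de_7,\ [e_2,e_7]=-de_6.$$ Let $\varphi=e^{123}+e^{145}+e^{167}+e^{246}-e^{257}-e^{347}-e^{356}\in\bigwedge^3\mathfrak{g}_{a,b,c,d}^*$. Then, for any such choice of values $(a,b,c,d)$, we have $\operatorname{div}T_\varphi=0$, i.e. $\varphi$ is divergence-free.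
   Context: $\{e^i\}$ is the dual basis and $e^{ijk}=e^i\wedge e^j\wedge e^k$; forms on the Lie algebra are identified with left-invariant forms on the simply connected Lie group, and $\mathrm{d}$ denotes the Chevalley–Eilenberg (exterior) differential. $\varphi$ is a $G_2$-structure inducing the inner product $g_\varphi=\langle\cdot,\cdot\rangle_\varphi$ for which $\{e_i\}$ is orthonormal, the volume form $e^{1\cdots7}$ and Hodge star $\star_\varphi$. Torsion forms: there are unique $\tau_0\in\mathbb{R}$, $\tau_1\in\bigwedge^1$, $\tau_2\in\bigwedge^2_{14}=\{\beta\in\bigwedge^2:\beta\wedge\star_\varphi\varphi=0\}$, $\tau_3\in\bigwedge^3_{27}=\{\gamma\in\bigwedge^3:\gamma\wedge\varphi=0,\ \gamma\wedge\star_\varphi\varphi=0\}$ with $$\mathrm{d}\varphi=\tau_0\star_\varphi\varphi+3\tau_1\wedge\varphi+\star_\varphi\tau_3,\qquad \mathrm{d}\star_\varphi\varphi=4\tau_1\wedge\star_\varphi\varphi+\star_\varphi\tau_2.$$ The full torsion tensor is the $(0,2)$-tensor $$T_\varphi=\frac{\tau_0}{4}g_\varphi-\star_\varphi(\tau_1\wedge\star_\varphi\varphi)-\frac12\tau_2-\frac14\jmath(\tau_3),\qquad \jmath(\tau)(v,w)=\star_\varphi(\iota_v\varphi\wedge\iota_w\varphi\wedge\tau).$$ With $\nabla$ the Levi-Civita connection of $g_\varphi$, the divergence $\operatorname{div}T_\varphi$ is the vector defined by $$\langle\operatorname{div}T_\varphi,e_j\rangle_\varphi=\sum_{i=1}^7(\nabla_{e_i}T_\varphi)(e_i,e_j)=-\sum_{i=1}^7T_\varphi(\nabla_{e_i}e_i,e_j)-\sum_{i=1}^7T_\varphi(e_i,\nabla_{e_i}e_j).$$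 *)

theory Defs
  imports "HOL-Analysis.Analysis"
begin

type_synonym vec7 = "real ^ 7"

text \<open>
  A form takes a list of vectors as argument, and a form of degree \<open>k\<close> vanishes on all lists
  whose length is not \<open>k\<close>; the degree is therefore part of the function, forms of degree \<open>0\<close>
  are determined by their value at \<open>[]\<close>, and equality of forms is equality of functions.
\<close>

type_synonym form = "vec7 list \<Rightarrow> real"

definition k_form :: "nat \<Rightarrow> form \<Rightarrow> bool" where
  "k_form k \<alpha> \<longleftrightarrow>
     (\<forall>vs. length vs \<noteq> k \<longrightarrow> \<alpha> vs = 0) \<and>
     (\<forall>vs i. length vs = k \<and> i < k \<longrightarrow> linear (\<lambda>x. \<alpha> (vs[i := x]))) \<and>
     (\<forall>vs. length vs = k \<and> \<not> distinct vs \<longrightarrow> \<alpha> vs = 0)"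

text \<open>
  The sum below is over all \<open>(p, q)\<close>-shuffles with \<open>p + q = length vs\<close>: such a shuffle is given by
  the set \<open>I\<close> of positions handed to \<open>\<alpha>\<close>. If \<open>\<alpha>\<close> has degree \<open>p\<close>, only the sets with
  \<open>p\<close> elements contribute. With this normalisation, \<open>(\<alpha> \<and> \<beta>)(v, w) = \<alpha>(v) \<beta>(w) - \<alpha>(w) \<beta>(v)\<close>
  for \<open>1\<close>-forms.
\<close>

definition shuffle_sign :: "nat \<Rightarrow> nat set \<Rightarrow> real" where
  "shuffle_sign n I = (-1) ^ card {(i, j). i \<in> I \<and> j \<in> {..<n} - I \<and> j < i}"

definition wedge :: "form \<Rightarrow> form \<Rightarrow> form" (infixr "\<curlywedge>" 70) where
  "\<alpha> \<curlywedge> \<beta> = (\<lambda>vs. \<Sum>I\<in>Pow {..<length vs}.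
     shuffle_sign (length vs) I * \<alpha> (nths vs I) * \<beta> (nths vs (- I)))"

definition contract :: "vec7 \<Rightarrow> form \<Rightarrow> form" where
  "contract v \<alpha> = (\<lambda>vs. \<alpha> (v # vs))"

text \<open>
  The Chevalley--Eilenberg differential for trivial coefficients:
  \<open>d \<alpha> (v\<^sub>0, \<dots>, v\<^sub>k) = \<Sum>\<^sub>i\<^sub><\<^sub>j (-1)\<^sup>i\<^sup>+\<^sup>j \<alpha> ([v\<^sub>i, v\<^sub>j], v\<^sub>0, \<dots>, v\<^sub>k)\<close> with \<open>v\<^sub>i, v\<^sub>j\<close> omitted
  from the tail.
\<close>

definition ce_diff :: "(vec7 \<Rightarrow> vec7 \<Rightarrow> vec7) \<Rightarrow> form \<Rightarrow> form" where
  "ce_diff br \<alpha> = (\<lambda>vs. \<Sum>(i, j)\<in>{(i, j). i < j \<and> j < length vs}.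
     (-1) ^ (i + j) * \<alpha> (br (vs ! i) (vs ! j) # nths vs (- {i, j})))"

text \<open>
  The basis is numbered \<open>1, \<dots>, 7\<close> by natural numbers; the index \<open>7\<close> is the element \<open>0\<close> of the
  type \<open>7\<close>, whose own order is not used.
\<close>

definition e_vec :: "nat \<Rightarrow> vec7" where
  "e_vec i = axis (of_nat i) 1"

definition covec :: "nat \<Rightarrow> form" where
  "covec i = (\<lambda>vs. if length vs = 1 then hd vs $ of_nat i else 0)"

fun e_form :: "nat list \<Rightarrow> form" where
  "e_form [] = (\<lambda>vs. if vs = [] then 1 else 0)"
| "e_form (i # is) = covec i \<curlywedge> e_form is"

definition vol :: form where
  "vol = e_form [1, 2, 3, 4, 5, 6, 7]"

text \<open>
  The Hodge star of the inner product of \<open>real ^ 7\<close>, for which \<open>e_vec 1, \<dots>, e_vec 7\<close> is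
  orthonormal, and of the orientation \<open>vol\<close>. The sum is over increasing index lists \<open>I\<close>; the formula says that
  \<open>\<star> e\<^sup>I\<close> is the contraction of \<open>vol\<close> with \<open>e\<^sub>I\<close>, so that \<open>e\<^sup>I \<and> \<star> e\<^sup>I = vol\<close>.
\<close>

definition hodge :: "form \<Rightarrow> form" ("\<star>_" [90] 90) where
  "\<star>\<alpha> = (\<lambda>ws. \<Sum>I\<in>Pow {1..7}.
     \<alpha> (map e_vec (sorted_list_of_set I)) * vol (map e_vec (sorted_list_of_set I) @ ws))"

text \<open>
  The torsion forms and the full torsion tensor are those of a 3-form \<open>\<phi>\<close> that is a
  \<open>G\<^sub>2\<close>-structure inducing the inner product of \<open>real ^ 7\<close> and the volume form \<open>vol\<close>, that is,
  one with \<open>\<iota>\<^sub>v \<phi> \<and> \<iota>\<^sub>w \<phi> \<and> \<phi> = 6 (v \<bullet> w) vol\<close>; lemma \<open>phi_induces_inner\<close> proves this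
  for the form \<open>phi\<close> below.
\<close>

definition torsion_forms ::
  "(vec7 \<Rightarrow> vec7 \<Rightarrow> vec7) \<Rightarrow> form \<Rightarrow> real \<Rightarrow> form \<Rightarrow> form \<Rightarrow> form \<Rightarrow> bool" where
  "torsion_forms br \<phi> \<tau>0 \<tau>1 \<tau>2 \<tau>3 \<longleftrightarrow>
     k_form 1 \<tau>1 \<and>
     k_form 2 \<tau>2 \<and> \<tau>2 \<curlywedge> \<star>\<phi> = (\<lambda>vs. 0) \<and>
     k_form 3 \<tau>3 \<and> \<tau>3 \<curlywedge> \<phi> = (\<lambda>vs. 0) \<and> \<tau>3 \<curlywedge> \<star>\<phi> = (\<lambda>vs. 0) \<and>
     ce_diff br \<phi> = (\<lambda>vs. \<tau>0 * (\<star>\<phi>) vs + 3 * (\<tau>1 \<curlywedge> \<phi>) vs + (\<star>\<tau>3) vs) \<and>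
     ce_diff br (\<star>\<phi>) = (\<lambda>vs. 4 * (\<tau>1 \<curlywedge> \<star>\<phi>) vs + (\<star>\<tau>2) vs)"

definition j_map :: "form \<Rightarrow> form \<Rightarrow> vec7 \<Rightarrow> vec7 \<Rightarrow> real" where
  "j_map \<phi> \<tau> v w = (\<star>(contract v \<phi> \<curlywedge> contract w \<phi> \<curlywedge> \<tau>)) []"

definition full_torsion :: "(vec7 \<Rightarrow> vec7 \<Rightarrow> vec7) \<Rightarrow> form \<Rightarrow> vec7 \<Rightarrow> vec7 \<Rightarrow> real" where
  "full_torsion br \<phi> v w =
     (case THE (\<tau>0, \<tau>1, \<tau>2, \<tau>3). torsion_forms br \<phi> \<tau>0 \<tau>1 \<tau>2 \<tau>3 of (\<tau>0, \<tau>1, \<tau>2, \<tau>3) \<Rightarrow>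
        \<tau>0 / 4 * (v \<bullet> w) - (\<star>(\<tau>1 \<curlywedge> \<star>\<phi>)) [v, w] - 1 / 2 * \<tau>2 [v, w] - 1 / 4 * j_map \<phi> \<tau>3 v w)"

text \<open>
  The Levi-Civita connection on left-invariant vector fields: inner products of such fields are
  constant, so compatibility with the metric says that \<open>\<nabla>\<^sub>x\<close> is skew-adjoint. Likewise, the
  derivative term in the covariant derivative of a left-invariant \<open>(0,2)\<close>-tensor vanishes.
\<close>

definition is_levi_civita :: "(vec7 \<Rightarrow> vec7 \<Rightarrow> vec7) \<Rightarrow> (vec7 \<Rightarrow> vec7 \<Rightarrow> vec7) \<Rightarrow> bool" where
  "is_levi_civita br D \<longleftrightarrow>
     bilinear D \<and>
     (\<forall>x y. D x y - D y x = br x y) \<and>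
     (\<forall>x y z. D x y \<bullet> z + y \<bullet> D x z = 0)"

definition levi_civita :: "(vec7 \<Rightarrow> vec7 \<Rightarrow> vec7) \<Rightarrow> vec7 \<Rightarrow> vec7 \<Rightarrow> vec7" where
  "levi_civita br = (THE D. is_levi_civita br D)"

definition cov_deriv ::
  "(vec7 \<Rightarrow> vec7 \<Rightarrow> vec7) \<Rightarrow> (vec7 \<Rightarrow> vec7 \<Rightarrow> real) \<Rightarrow> vec7 \<Rightarrow> vec7 \<Rightarrow> vec7 \<Rightarrow> real" where
  "cov_deriv br T x y z = - T (levi_civita br x y) z - T y (levi_civita br x z)"

definition divergence :: "(vec7 \<Rightarrow> vec7 \<Rightarrow> vec7) \<Rightarrow> (vec7 \<Rightarrow> vec7 \<Rightarrow> real) \<Rightarrow> vec7" where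
  "divergence br T = (\<Sum>j=1..7. (\<Sum>i=1..7. cov_deriv br T (e_vec i) (e_vec i) (e_vec j)) *\<^sub>R e_vec j)"

text \<open>
  The bilinear extension of the brackets of basis vectors listed in lemma \<open>g_bracket_basis\<close>;
  lemma \<open>g_bracket_lie\<close> shows that it is a Lie bracket.
\<close>

definition g_bracket :: "real \<Rightarrow> real \<Rightarrow> real \<Rightarrow> real \<Rightarrow> vec7 \<Rightarrow> vec7 \<Rightarrow> vec7" where
  "g_bracket a b c d x y =
     (a * (x $ 1 * y $ 4 - x $ 4 * y $ 1) + c * (x $ 2 * y $ 4 - x $ 4 * y $ 2)) *\<^sub>R e_vec 5
   - (a * (x $ 1 * y $ 5 - x $ 5 * y $ 1) + c * (x $ 2 * y $ 5 - x $ 5 * y $ 2)) *\<^sub>R e_vec 4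
   + (b * (x $ 1 * y $ 6 - x $ 6 * y $ 1) + d * (x $ 2 * y $ 6 - x $ 6 * y $ 2)) *\<^sub>R e_vec 7
   - (b * (x $ 1 * y $ 7 - x $ 7 * y $ 1) + d * (x $ 2 * y $ 7 - x $ 7 * y $ 2)) *\<^sub>R e_vec 6"

definition phi :: form where
  "phi = (\<lambda>vs. e_form [1,2,3] vs + e_form [1,4,5] vs + e_form [1,6,7] vs + e_form [2,4,6] vs
             - e_form [2,5,7] vs - e_form [3,4,7] vs - e_form [3,5,6] vs)"

lemma e_vec_nth [simp]:
  "e_vec 1 $ k = (if k = 1 then 1 else 0)" "e_vec (Suc 0) $ k = (if k = 1 then 1 else 0)"
  "e_vec (numeral n) $ k = (if k = numeral n then 1 else 0)"
  by (auto simp: e_vec_def axis_def)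

lemma UNIV_7: "(UNIV :: 7 set) = {1, 2, 3, 4, 5, 6, 7}"
proof -
  have "k \<in> {1, 2, 3, 4, 5, 6, 7}" for k :: 7
  proof (cases k)
    case (of_int z)
    then have "z \<in> {0, 1, 2, 3, 4, 5, 6}" by auto
    with of_int show ?thesis by auto
  qed
  then show ?thesis by blast
qed

lemma vec7_eqI:
  fixes x y :: vec7
  assumes "x $ 1 = y $ 1" "x $ 2 = y $ 2" "x $ 3 = y $ 3" "x $ 4 = y $ 4"
    "x $ 5 = y $ 5" "x $ 6 = y $ 6" "x $ 7 = y $ 7"
  shows "x = y"
proof -
  have "x $ k = y $ k" for k
    using UNIV_I[of k] assms unfolding UNIV_7 by blast
  then show ?thesis by (simp add: vec_eq_iff)
qed

lemma inner_vec7: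
  "(x :: vec7) \<bullet> y = x $ 1 * y $ 1 + x $ 2 * y $ 2 + x $ 3 * y $ 3 + x $ 4 * y $ 4
     + x $ 5 * y $ 5 + x $ 6 * y $ 6 + x $ 7 * y $ 7"
  unfolding inner_vec_def UNIV_7 by simp

lemma g_bracket_basis:
  "g_bracket a b c d (e_vec 1) (e_vec 4) = a *\<^sub>R e_vec 5"
  "g_bracket a b c d (e_vec 1) (e_vec 5) = - a *\<^sub>R e_vec 4"
  "g_bracket a b c d (e_vec 1) (e_vec 6) = b *\<^sub>R e_vec 7"
  "g_bracket a b c d (e_vec 1) (e_vec 7) = - b *\<^sub>R e_vec 6"
  "g_bracket a b c d (e_vec 2) (e_vec 4) = c *\<^sub>R e_vec 5"
  "g_bracket a b c d (e_vec 2) (e_vec 5) = - c *\<^sub>R e_vec 4"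
  "g_bracket a b c d (e_vec 2) (e_vec 6) = d *\<^sub>R e_vec 7"
  "g_bracket a b c d (e_vec 2) (e_vec 7) = - d *\<^sub>R e_vec 6"
  "g_bracket a b c d (e_vec 1) (e_vec 2) = 0"
  "g_bracket a b c d (e_vec 1) (e_vec 3) = 0"
  "g_bracket a b c d (e_vec 2) (e_vec 3) = 0"
  "i \<in> {3, 4, 5, 6, 7} \<Longrightarrow> j \<in> {3, 4, 5, 6, 7} \<Longrightarrow> g_bracket a b c d (e_vec i) (e_vec j) = 0"
  by (auto simp: g_bracket_def)

lemma g_bracket_lie:
  "bilinear (g_bracket a b c d)"
  "g_bracket a b c d x x = 0"
  "g_bracket a b c d x (g_bracket a b c d y z) + g_bracket a b c d y (g_bracket a b c d z x)
     + g_bracket a b c d z (g_bracket a b c d x y) = 0"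
  unfolding bilinear_def
    by (auto intro!: linearI vec7_eqI simp: g_bracket_def algebra_simps)

lemma wedge_Nil: "(\<alpha> \<curlywedge> \<beta>) [] = \<alpha> [] * \<beta> []"
  by (simp add: wedge_def shuffle_sign_def)

lemma shuffle_sign_Suc:
  assumes "I \<subseteq> {..<n}"
  shows "shuffle_sign (Suc n) (insert 0 (Suc ` I)) = shuffle_sign n I"
    and "shuffle_sign (Suc n) (Suc ` I) = (-1) ^ card I * shuffle_sign n I"
proof -
  define S where "S = {(i, j). i \<in> I \<and> j \<in> {..<n} - I \<and> j < i}"
  have fin: "finite I" "finite S"
    using assms finite_subset[of S "{..<n} \<times> {..<n}"] finite_subset[of I] by (auto simp: S_def)
  have S: "card (map_prod Suc Suc ` S) = card S"
    by (intro card_image inj_onI) auto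
  have *: "{(i, j). i \<in> insert 0 (Suc ` I) \<and> j \<in> {..<Suc n} - insert 0 (Suc ` I) \<and> j < i}
    = map_prod Suc Suc ` S"
    by (auto simp: S_def image_iff gr0_conv_Suc Bex_def)
  have **: "{(i, j). i \<in> Suc ` I \<and> j \<in> {..<Suc n} - Suc ` I \<and> j < i}
    = map_prod Suc Suc ` S \<union> (\<lambda>i. (Suc i, 0)) ` I" (is "?L = ?R")
  proof (intro equalityI subsetI)
    fix z assume "z \<in> ?L" then show "z \<in> ?R"
      by (cases "snd z") (auto simp: S_def image_iff Bex_def)
  qed (auto simp: S_def)
  have "card (map_prod Suc Suc ` S \<union> (\<lambda>i. (Suc i, 0)) ` I)
      = card (map_prod Suc Suc ` S) + card ((\<lambda>i. (Suc i, 0 :: nat)) ` I)"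
    using fin by (intro card_Un_disjoint) auto
  also have "\<dots> = card S + card I"
    using S by (simp add: card_image inj_on_def)
  finally show "shuffle_sign (Suc n) (Suc ` I) = (-1) ^ card I * shuffle_sign n I"
    unfolding shuffle_sign_def ** by (simp add: S_def power_add)
  show "shuffle_sign (Suc n) (insert 0 (Suc ` I)) = shuffle_sign n I"
    unfolding shuffle_sign_def * using S by (simp add: S_def)
qed

lemma wedge_Cons:
  assumes "\<And>vs. length vs \<noteq> p \<Longrightarrow> \<alpha> vs = 0"
  shows "(\<alpha> \<curlywedge> \<beta>) (v # vs)
    = (contract v \<alpha> \<curlywedge> \<beta>) vs + (-1) ^ p * (\<alpha> \<curlywedge> contract v \<beta>) vs"
proof -
  define n where "n = length vs"
  define f where "f I = shuffle_sign (Suc n) I * \<alpha> (nths (v # vs) I) * \<beta> (nths (v # vs) (- I))" for I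
  have Pow_eq: "Pow {..<Suc n} = (\<lambda>I. insert 0 (Suc ` I)) ` Pow {..<n} \<union> image Suc ` Pow {..<n}"
    by (simp add: lessThan_Suc_eq_insert_0 Pow_insert image_Pow_surj image_image Un_commute
        flip: image_comp) (auto simp: image_Pow_surj[symmetric])
  have inj1: "inj_on (\<lambda>I. insert 0 (Suc ` I)) (Pow {..<n})"
  proof (rule inj_onI)
    fix I J assume "insert 0 (Suc ` I) = insert 0 (Suc ` J)"
    then have "Suc ` I = Suc ` J" by (metis Diff_insert_absorb imageE nat.distinct(1))
    then show "I = J" by (simp add: inj_image_eq_iff)
  qed
  have inj2: "inj_on (image Suc) (Pow {..<n})"
    by (auto intro!: inj_onI simp: inj_image_eq_iff)
  have f1: "f (insert 0 (Suc ` I))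
      = shuffle_sign n I * contract v \<alpha> (nths vs I) * \<beta> (nths vs (- I))"
    if "I \<in> Pow {..<n}" for I
  proof -
    have "{j. Suc j \<in> insert 0 (Suc ` I)} = I" "{j. Suc j \<in> - insert 0 (Suc ` I)} = - I" by auto
    then show ?thesis using that
      by (simp add: f_def nths_Cons shuffle_sign_Suc contract_def image_iff)
  qed
  have f2: "f (Suc ` I)
      = (-1) ^ p * (shuffle_sign n I * \<alpha> (nths vs I) * contract v \<beta> (nths vs (- I)))"
    if "I \<in> Pow {..<n}" for I
  proof -
    have "{j. Suc j \<in> Suc ` I} = I" "{j. Suc j \<in> - Suc ` I} = - I" by auto
    moreover have "card I = p" if "\<alpha> (nths vs I) \<noteq> 0"
    proof -
      have "{i. i < length vs \<and> i \<in> I} = I" using \<open>I \<in> Pow {..<n}\<close> by (auto simp: n_def)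
      then show ?thesis using assms[of "nths vs I"] that by (auto simp: length_nths)
    qed
    ultimately show ?thesis using that
      by (cases "\<alpha> (nths vs I) = 0")
        (auto simp: f_def nths_Cons shuffle_sign_Suc contract_def image_iff)
  qed
  have "(\<alpha> \<curlywedge> \<beta>) (v # vs) = sum f (Pow {..<Suc n})"
    by (simp add: wedge_def f_def n_def)
  also have "\<dots> = sum f ((\<lambda>I. insert 0 (Suc ` I)) ` Pow {..<n}) + sum f (image Suc ` Pow {..<n})"
    unfolding Pow_eq by (intro sum.union_disjoint) auto
  also have "\<dots> = (\<Sum>I\<in>Pow {..<n}. f (insert 0 (Suc ` I))) + (\<Sum>I\<in>Pow {..<n}. f (Suc ` I))"
    by (simp add: sum.reindex[OF inj1] sum.reindex[OF inj2])
  also have "\<dots> = (contract v \<alpha> \<curlywedge> \<beta>) vs + (-1) ^ p * (\<alpha> \<curlywedge> contract v \<beta>) vs"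
    by (simp add: f1 f2 wedge_def n_def sum_distrib_left)
  finally show ?thesis .
qed

lemma wedge_degree:
  assumes "\<And>vs. length vs \<noteq> p \<Longrightarrow> \<alpha> vs = 0" "\<And>vs. length vs \<noteq> q \<Longrightarrow> \<beta> vs = 0"
    and "length vs \<noteq> p + q"
  shows "(\<alpha> \<curlywedge> \<beta>) vs = 0"
  unfolding wedge_def
proof (intro sum.neutral ballI)
  fix I
  have "length (nths vs I) + length (nths vs (- I)) = length vs"
  proof (induction vs arbitrary: I)
    case (Cons v vs)
    have "{j. Suc j \<in> - I} = - {j. Suc j \<in> I}" by auto
    with Cons[of "{j. Suc j \<in> I}"] show ?case by (simp add: nths_Cons)
  qed simp
  then have "length (nths vs I) \<noteq> p \<or> length (nths vs (- I)) \<noteq> q" using assms(3) by auto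
  then show "shuffle_sign (length vs) I * \<alpha> (nths vs I) * \<beta> (nths vs (- I)) = 0"
    using assms(1,2) by auto
qed

lemma e_form_degree: "length vs \<noteq> length is \<Longrightarrow> e_form is vs = 0"
proof (induction "is" arbitrary: vs)
  case (Cons i "is")
  then show ?case
    by (simp del: length_greater_0_conv, intro wedge_degree[of 1 _ "length is"]) (auto simp: covec_def)
qed auto

lemma scalar_wedge: "((\<lambda>vs. if vs = [] then r else 0) \<curlywedge> \<beta>) vs = r * \<beta> vs"
proof (induction vs arbitrary: \<beta>)
  case Nil
  show ?case by (simp add: wedge_Nil)
next
  case (Cons v vs)
  have "contract v (\<lambda>vs. if vs = [] then r else 0) = (\<lambda>vs. 0)"
    by (simp add: contract_def)
  moreover have "((\<lambda>vs. 0) \<curlywedge> \<beta>) vs = 0" by (simp add: wedge_def)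
  ultimately show ?case
    by (subst wedge_Cons[where p = 0]) (auto simp: Cons contract_def)
qed

lemma covec_wedge_Cons:
  "(covec i \<curlywedge> \<beta>) (v # vs) = v $ of_nat i * \<beta> vs - (covec i \<curlywedge> contract v \<beta>) vs"
proof -
  have "contract v (covec i) = (\<lambda>vs. if vs = [] then v $ of_nat i else 0)"
    by (auto simp: contract_def covec_def)
  then show ?thesis
    by (subst wedge_Cons[where p = 1]) (auto simp: scalar_wedge covec_def)
qed

lemma phi_degree: "length vs \<noteq> 3 \<Longrightarrow> phi vs = 0"
  unfolding phi_def by (subst e_form_degree, simp, (subst e_form_degree, simp)+) simp

lemma covec_wedge_Nil: "(covec i \<curlywedge> \<beta>) [] = 0"
  by (simp add: wedge_Nil covec_def)

lemma contract_apply: "contract v \<alpha> vs = \<alpha> (v # vs)"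
  by (simp add: contract_def)

lemmas e_form_eval = covec_wedge_Nil covec_wedge_Cons contract_apply

lemma vol_basis: "vol (map e_vec [1, 2, 3, 4, 5, 6, 7]) = 1"
  by (simp add: vol_def e_form_eval)

lemma e_form_3:
  "e_form [i, j, k] [u, v, w] =
     u $ of_nat i * (v $ of_nat j * w $ of_nat k - v $ of_nat k * w $ of_nat j)
   - v $ of_nat i * (u $ of_nat j * w $ of_nat k - u $ of_nat k * w $ of_nat j)
   + w $ of_nat i * (u $ of_nat j * v $ of_nat k - u $ of_nat k * v $ of_nat j)"
  by (simp add: e_form_eval algebra_simps)

lemma phi_eval:
  "phi [u, v, w] =
     u $ 1 * (v $ 2 * w $ 3 - v $ 3 * w $ 2 + v $ 4 * w $ 5 - v $ 5 * w $ 4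
       + v $ 6 * w $ 7 - v $ 7 * w $ 6)
   + u $ 2 * (v $ 3 * w $ 1 - v $ 1 * w $ 3 + v $ 4 * w $ 6 - v $ 6 * w $ 4
       - v $ 5 * w $ 7 + v $ 7 * w $ 5)
   + u $ 3 * (v $ 1 * w $ 2 - v $ 2 * w $ 1 - v $ 4 * w $ 7 + v $ 7 * w $ 4
       - v $ 5 * w $ 6 + v $ 6 * w $ 5)
   + u $ 4 * (v $ 5 * w $ 1 - v $ 1 * w $ 5 + v $ 6 * w $ 2 - v $ 2 * w $ 6
       - v $ 7 * w $ 3 + v $ 3 * w $ 7)
   + u $ 5 * (v $ 1 * w $ 4 - v $ 4 * w $ 1 - v $ 7 * w $ 2 + v $ 2 * w $ 7
       - v $ 6 * w $ 3 + v $ 3 * w $ 6)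
   + u $ 6 * (v $ 7 * w $ 1 - v $ 1 * w $ 7 + v $ 2 * w $ 4 - v $ 4 * w $ 2
       - v $ 3 * w $ 5 + v $ 5 * w $ 3)
   + u $ 7 * (v $ 1 * w $ 6 - v $ 6 * w $ 1 - v $ 2 * w $ 5 + v $ 5 * w $ 2
       - v $ 3 * w $ 4 + v $ 4 * w $ 3)"
  unfolding phi_def e_form_3 by (simp add: algebra_simps)

lemma contract_phi_wedge:
  "(contract v phi \<curlywedge> \<beta>) [] = 0"
  "(contract v phi \<curlywedge> \<beta>) (x # xs) =
     (contract x (contract v phi) \<curlywedge> \<beta>) xs + (contract v phi \<curlywedge> contract x \<beta>) xs"
  "(contract x (contract v phi) \<curlywedge> \<beta>) [] = 0"
  "(contract x (contract v phi) \<curlywedge> \<beta>) (y # ys) =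
     phi [v, x, y] * \<beta> ys - (contract x (contract v phi) \<curlywedge> contract y \<beta>) ys"
proof -
  have "contract y (contract x (contract v phi)) = (\<lambda>vs. if vs = [] then phi [v, x, y] else 0)"
    by (auto simp: contract_def phi_degree)
  then show "(contract x (contract v phi) \<curlywedge> \<beta>) (y # ys) =
     phi [v, x, y] * \<beta> ys - (contract x (contract v phi) \<curlywedge> contract y \<beta>) ys"
    by (subst wedge_Cons[where p = 1]) (auto simp: scalar_wedge contract_def phi_degree)
  show "(contract v phi \<curlywedge> \<beta>) (x # xs) =
     (contract x (contract v phi) \<curlywedge> \<beta>) xs + (contract v phi \<curlywedge> contract x \<beta>) xs"
    by (subst wedge_Cons[where p = 2]) (auto simp: contract_def phi_degree)
qed (simp_all add: wedge_Nil contract_def phi_degree)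

lemma phi_basis:
  "phi [v, e_vec (Suc 0), e_vec 2] = v $ 3"
  "phi [v, e_vec (Suc 0), e_vec 3] = - v $ 2"
  "phi [v, e_vec (Suc 0), e_vec 4] = v $ 5"
  "phi [v, e_vec (Suc 0), e_vec 5] = - v $ 4"
  "phi [v, e_vec (Suc 0), e_vec 6] = v $ 7"
  "phi [v, e_vec (Suc 0), e_vec 7] = - v $ 6"
  "phi [v, e_vec 2, e_vec 3] = v $ 1"
  "phi [v, e_vec 2, e_vec 4] = v $ 6"
  "phi [v, e_vec 2, e_vec 5] = - v $ 7"
  "phi [v, e_vec 2, e_vec 6] = - v $ 4"
  "phi [v, e_vec 2, e_vec 7] = v $ 5"
  "phi [v, e_vec 3, e_vec 4] = - v $ 7"
  "phi [v, e_vec 3, e_vec 5] = - v $ 6"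
  "phi [v, e_vec 3, e_vec 6] = v $ 5"
  "phi [v, e_vec 3, e_vec 7] = v $ 4"
  "phi [v, e_vec 4, e_vec 5] = v $ 1"
  "phi [v, e_vec 4, e_vec 6] = v $ 2"
  "phi [v, e_vec 4, e_vec 7] = - v $ 3"
  "phi [v, e_vec 5, e_vec 6] = - v $ 3"
  "phi [v, e_vec 5, e_vec 7] = - v $ 2"
  "phi [v, e_vec 6, e_vec 7] = v $ 1"
  by (simp_all add: phi_eval)

lemma phi_induces_inner:
  "(contract v phi \<curlywedge> contract w phi \<curlywedge> phi) (map e_vec [1, 2, 3, 4, 5, 6, 7]) = 6 * (v \<bullet> w)"
  by (simp add: contract_phi_wedge contract_apply phi_degree phi_basis inner_vec7 algebra_simps)

end

theory Submission
  imports Defs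
begin

text \<open>
  The bracket vanishes on \<open>e\<^sub>3, \<dots>, e\<^sub>7\<close> and \<open>ad e\<^sub>1\<close>, \<open>ad e\<^sub>2\<close> are skew, so the Levi-Civita connection is
  \<open>\<nabla>\<^sub>x = x\<^sub>1 ad e\<^sub>1 + x\<^sub>2 ad e\<^sub>2\<close>. Hence every \<open>\<nabla>\<^bsub>e\<^sub>i\<^esub> e\<^sub>i\<close> vanishes, and \<open>div T\<close> only involves the entries
  \<open>T (e\<^sub>i, e\<^sub>k)\<close> with \<open>i \<in> {1, 2}\<close> and \<open>k \<in> {4, 5, 6, 7}\<close>. These vanish by the explicit torsion forms
  \<open>\<tau>\<^sub>0 = - 4/7 (a + b)\<close>, \<open>\<tau>\<^sub>1 = - 1/6 (c + d) e\<^sup>3\<close>, \<open>\<tau>\<^sub>2\<close>, \<open>\<tau>\<^sub>3\<close> below, which are combinations of \<open>e\<^sup>I\<close> with an even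
  number of indices in \<open>{4, 5, 6, 7}\<close>. The torsion forms are unique because a relation
  \<open>s\<^sub>0 \<star>\<phi> + 3 \<sigma>\<^sub>1 \<and> \<phi> + \<star>\<sigma>\<^sub>3 = 0\<close> with \<open>\<sigma>\<^sub>3 \<and> \<phi> = 0\<close> and \<open>\<sigma>\<^sub>3 \<and> \<star>\<phi> = 0\<close> is a linear system on basis vectors
  that forces \<open>s\<^sub>0\<close>, \<open>\<sigma>\<^sub>1\<close> and \<open>\<sigma>\<^sub>3\<close> to vanish.
\<close>

section \<open>Alternating forms\<close>

lemma k_form_degree: "k_form k \<alpha> \<Longrightarrow> length vs \<noteq> k \<Longrightarrow> \<alpha> vs = 0"
  by (simp add: k_form_def)

text \<open>For a tail of the wrong length the function is zero, hence linear; this makes the rule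
  available for every tail.\<close>

lemma k_form_linear_head:
  assumes "k_form k \<alpha>" shows "linear (\<lambda>v. \<alpha> (v # vs))"
proof (cases "Suc (length vs) = k")
  case True
  \<comment> \<open>\<open>undefined\<close> is a placeholder that the update at position 0
    overwrites.\<close>
  then have "linear (\<lambda>x. \<alpha> ((undefined # vs)[0 := x]))"
    using assms unfolding k_form_def by fastforce
  then show ?thesis by simp
next
  case False
  then have "(\<lambda>v. \<alpha> (v # vs)) = (\<lambda>v. 0)"
    using assms by (auto simp: k_form_def)
  then show ?thesis by (simp add: linear_zero)
qed

lemma k_form_not_distinct: "k_form k \<alpha> \<Longrightarrow> \<not> distinct vs \<Longrightarrow> \<alpha> vs = 0"
  unfolding k_form_def by blast

lemma k_form_zero: "k_form k (\<lambda>vs. 0)"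
  by (simp add: k_form_def linear_zero)

lemma k_form_add: "k_form k \<alpha> \<Longrightarrow> k_form k \<beta> \<Longrightarrow> k_form k (\<lambda>vs. \<alpha> vs + \<beta> vs)"
  unfolding k_form_def by (auto intro: linear_compose_add)

lemma k_form_cmult: "k_form k \<alpha> \<Longrightarrow> k_form k (\<lambda>vs. r * \<alpha> vs)"
  unfolding k_form_def using linear_compose_scale_right[where c = r and 'b = real] by auto

lemma k_form_uminus: "k_form k \<alpha> \<Longrightarrow> k_form k (\<lambda>vs. - \<alpha> vs)"
  using k_form_cmult[of k \<alpha> "-1"] by simp

lemma k_form_diff: "k_form k \<alpha> \<Longrightarrow> k_form k \<beta> \<Longrightarrow> k_form k (\<lambda>vs. \<alpha> vs - \<beta> vs)"
  using k_form_add[OF _ k_form_uminus, of k \<alpha> \<beta>] by simp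

lemma k_form_sum: "(\<And>i. i \<in> A \<Longrightarrow> k_form k (\<alpha> i)) \<Longrightarrow> k_form k (\<lambda>vs. \<Sum>i\<in>A. \<alpha> i vs)"
  by (induction A rule: infinite_finite_induct) (simp_all add: k_form_zero k_form_add)

lemmas k_form_linear_intros = k_form_zero k_form_add k_form_cmult k_form_uminus k_form_diff

text \<open>Polarisation of \<alpha>(v + w, v + w, ...) = 0. The hypotheses concern the first two
  slots only, so that it applies inside \<open>k_form_SucI\<close>, before \<alpha> is known to be a
  form.\<close>

lemma alternating_swap:
  fixes \<alpha> :: form
  assumes lin1: "\<And>vs. linear (\<lambda>v. \<alpha> (v # vs))"
    and lin2: "\<And>u vs. linear (\<lambda>v. \<alpha> (u # v # vs))"
    and alt: "\<And>v vs. \<alpha> (v # v # vs) = 0"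
  shows "\<alpha> (v # w # vs) = - \<alpha> (w # v # vs)"
proof -
  have "0 = \<alpha> ((v + w) # (v + w) # vs)" by (simp add: alt)
  also have "\<dots> = \<alpha> (v # w # vs) + \<alpha> (w # v # vs)"
    using linear_add[OF lin1, of v w "(v + w) # vs"] linear_add[OF lin2, of _ v w vs] by (simp add: alt)
  finally show ?thesis by simp
qed

text \<open>In degree 0 the truncated \<open>k - 1\<close> is 0 and the contraction is the zero
  form, which \<open>k_form\<close> accepts in every degree.\<close>

lemma k_form_contract:
  assumes "k_form k \<alpha>" shows "k_form (k - 1) (contract v \<alpha>)"
proof (cases k)
  case 0
  then have "contract v \<alpha> = (\<lambda>vs. 0)"
    using assms by (auto simp: contract_def k_form_def)
  then show ?thesis by (simp add: k_form_zero)
next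
  case (Suc n)
  have "linear (\<lambda>x. \<alpha> (v # vs[i := x]))" if "length vs = n" "i < n" for vs i
  proof -
    have "linear (\<lambda>x. \<alpha> ((v # vs)[Suc i := x]))"
      using assms that Suc unfolding k_form_def by (metis Suc_less_eq length_Cons)
    then show ?thesis by simp
  qed
  then show ?thesis
    using assms by (auto simp: k_form_def contract_def Suc)
qed

text \<open>The inductive step behind the closure results for the wedge product,
  \<open>lie_deriv\<close> and \<open>ce_diff\<close>: contractions carry the inductive hypothesis,
  and only the first slot and a repetition in the first two slots remain to be checked.\<close>

lemma k_form_SucI:
  assumes nil: "\<alpha> [] = 0"
    and lin: "\<And>vs. linear (\<lambda>v. \<alpha> (v # vs))"
    and con: "\<And>v. k_form k (contract v \<alpha>)"
    and alt: "\<And>v vs. \<alpha> (v # v # vs) = 0"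
  shows "k_form (Suc k) \<alpha>"
  unfolding k_form_def
proof (intro conjI allI impI; (elim conjE)?)
  fix vs :: "vec7 list"
  show "\<alpha> vs = 0" if "length vs \<noteq> Suc k"
    using that nil k_form_degree[OF con] by (cases vs) (auto simp: contract_def)
  show "linear (\<lambda>x. \<alpha> (vs[i := x]))" if "length vs = Suc k" "i < Suc k" for i
  proof (cases vs)
    case (Cons v ws)
    show ?thesis
    proof (cases i)
      case 0
      then show ?thesis using lin Cons by simp
    next
      case (Suc j)
      then have "linear (\<lambda>x. contract v \<alpha> (ws[j := x]))"
        using con[of v] that Cons by (simp add: k_form_def)
      then show ?thesis by (simp add: Cons Suc contract_def)
    qed
  qed (use that in simp)
  show "\<alpha> vs = 0" if "length vs = Suc k" "\<not> distinct vs"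
  proof (cases vs)
    case (Cons v ws)
    have swap: "\<alpha> (x # y # zs) = - \<alpha> (y # x # zs)" for x y zs
      using lin k_form_linear_head[OF con] alt
      by (intro alternating_swap) (auto simp: contract_def)
    show ?thesis
    proof (cases "distinct ws")
      case False
      then show ?thesis using k_form_not_distinct[OF con[of v]] by (simp add: Cons contract_def)
    next
      case True
      then have "v \<in> set ws" using that Cons by simp
      then obtain ys zs where ws: "ws = ys @ v # zs" by (auto simp: in_set_conv_decomp)
      show ?thesis
      proof (cases ys)
        case Nil
        then show ?thesis using alt by (simp add: Cons ws)
      next
        \<comment> \<open>Exchanging \<open>v\<close> and \<open>y\<close> puts both copies of
          \<open>v\<close> behind \<open>y\<close>, where the contraction with \<open>y\<close>
          vanishes.\<close>
        case (Cons y ys')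
        have "contract y \<alpha> (v # ys' @ v # zs) = 0"
          by (rule k_form_not_distinct[OF con]) simp
        then show ?thesis using swap[of v y] by (simp add: \<open>vs = v # ws\<close> ws Cons contract_def)
      qed
    qed
  qed (use that in simp)
qed

lemma k_form_alternating: "k_form k \<alpha> \<Longrightarrow> \<alpha> (v # v # vs) = 0"
  by (rule k_form_not_distinct) simp_all

lemma k_form_swap:
  assumes "k_form k \<alpha>" shows "\<alpha> (v # w # vs) = - \<alpha> (w # v # vs)"
  using k_form_linear_head[OF assms] k_form_linear_head[OF k_form_contract[OF assms]]
    k_form_alternating[OF assms]
  by (intro alternating_swap) (auto simp: contract_def)

lemma contract_0_form: "k_form 0 \<alpha> \<Longrightarrow> contract v \<alpha> = (\<lambda>vs. 0)"
  by (auto simp: contract_def k_form_def)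

lemma k_form_append:
  "k_form (length us + k) \<alpha> \<Longrightarrow> k_form k (\<lambda>vs. \<alpha> (us @ vs))"
proof (induction us arbitrary: \<alpha>)
  case (Cons u us)
  have "k_form (length us + k) (contract u \<alpha>)"
    using k_form_contract[OF Cons.prems] by simp
  then show ?case using Cons.IH by (fastforce simp: contract_def)
qed simp

section \<open>Degree and alternation of wedge products and Hodge stars\<close>

lemma wedge_zero_left [simp]: "((\<lambda>vs. 0) \<curlywedge> \<beta>) = (\<lambda>vs. 0)"
  by (simp add: wedge_def)

lemma wedge_zero_right [simp]: "(\<alpha> \<curlywedge> (\<lambda>vs. 0)) = (\<lambda>vs. 0)"
  by (simp add: wedge_def)

lemma wedge_diff_left: "((\<lambda>vs. \<alpha> vs - \<alpha>' vs) \<curlywedge> \<beta>) vs = (\<alpha> \<curlywedge> \<beta>) vs - (\<alpha>' \<curlywedge> \<beta>) vs"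
  by (simp add: wedge_def algebra_simps sum_subtractf)

lemma wedge_0_forms: "k_form 0 \<alpha> \<Longrightarrow> k_form 0 \<beta> \<Longrightarrow> k_form 0 (\<alpha> \<curlywedge> \<beta>)"
  by (auto simp: k_form_def intro!: wedge_degree[of 0 \<alpha> 0 \<beta>])

text \<open>Contraction is a graded derivation of the wedge product, so each contraction of the
  product is a sum of products of total degree one less.\<close>

lemma k_form_wedge:
  assumes "k_form p \<alpha>" "k_form q \<beta>"
  shows "k_form (p + q) (\<alpha> \<curlywedge> \<beta>)"
  using assms
proof (induction "p + q" arbitrary: p q \<alpha> \<beta>)
  case 0
  then show ?case by (simp add: wedge_0_forms)
next
  case (Suc n)
  note deg = k_form_degree[OF Suc.prems(1)]
  note deg' = k_form_degree[OF k_form_contract[OF Suc.prems(1)]]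
  have Cons: "(\<alpha> \<curlywedge> \<gamma>) (v # vs) = (contract v \<alpha> \<curlywedge> \<gamma>) vs + (-1) ^ p * (\<alpha> \<curlywedge> contract v \<gamma>) vs" for \<gamma> v vs
    using deg by (rule wedge_Cons)
  \<comment> \<open>The sign is that of degree \<open>p - 1\<close>; for \<open>p = 0\<close> both
    sides vanish together with \<open>contract v \<alpha>\<close>.\<close>
  have Cons': "(contract v \<alpha> \<curlywedge> \<beta>) (w # vs)
      = (contract w (contract v \<alpha>) \<curlywedge> \<beta>) vs - (-1) ^ p * (contract v \<alpha> \<curlywedge> contract w \<beta>) vs" for v w vs
  proof (cases p)
    case 0
    then show ?thesis using Suc.prems by (simp add: contract_0_form k_form_zero)
  next
    case (Suc p')
    then show ?thesis by (subst wedge_Cons[OF deg']) auto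
  qed
  have vv: "contract v (contract v \<gamma>) = (\<lambda>vs. 0)" if "k_form k \<gamma>" for k v \<gamma>
    using k_form_alternating[OF that] by (auto simp: contract_def)
  have con: "k_form n (contract v (\<alpha> \<curlywedge> \<beta>))" for v
  proof -
    have "k_form n (contract v \<alpha> \<curlywedge> \<beta>)"
    proof (cases p)
      case 0
      then show ?thesis using Suc.prems by (simp add: contract_0_form k_form_zero)
    next
      case (Suc p')
      then show ?thesis
        using Suc.hyps(1)[of "p - 1" q "contract v \<alpha>" \<beta>] Suc.hyps(2) Suc.prems
          k_form_contract[OF Suc.prems(1)] by simp
    qed
    moreover have "k_form n (\<alpha> \<curlywedge> contract v \<beta>)"
    proof (cases q)
      case 0
      then show ?thesis using Suc.prems by (simp add: contract_0_form k_form_zero)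
    next
      case (Suc q')
      then show ?thesis
        using Suc.hyps(1)[of p "q - 1" \<alpha> "contract v \<beta>"] Suc.hyps(2) Suc.prems
          k_form_contract[OF Suc.prems(2)] by simp
    qed
    ultimately show ?thesis
      by (simp add: Cons contract_def[of v "\<alpha> \<curlywedge> \<beta>"] k_form_linear_intros)
  qed
  have "linear (\<lambda>v. (\<alpha> \<curlywedge> \<beta>) (v # vs))" for vs
    unfolding Cons unfolding wedge_def sum_distrib_left contract_def
    by (intro linearI)
      (simp_all add: sum.distrib sum_distrib_left Suc.prems[THEN k_form_linear_head, THEN linear_add]
          Suc.prems[THEN k_form_linear_head, THEN linear_cmul] algebra_simps)
  \<comment> \<open>The two mixed products of \<open>contract v \<alpha>\<close> and
    \<open>contract v \<beta>\<close> enter with opposite signs.\<close>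
  moreover have "(\<alpha> \<curlywedge> \<beta>) (v # v # vs) = 0" for v vs
    using Suc.prems by (simp add: Cons Cons' vv algebra_simps flip: power_add mult_2)
  moreover have "(\<alpha> \<curlywedge> \<beta>) [] = 0"
    using Suc.hyps(2) k_form_degree[OF Suc.prems(1), of "[]"] k_form_degree[OF Suc.prems(2), of "[]"]
    by (cases p) (simp_all add: wedge_Nil)
  ultimately show ?case
    unfolding Suc.hyps(2)[symmetric] using con by (intro k_form_SucI) auto
qed

lemma k_form_covec: "k_form 1 (covec i)"
  unfolding One_nat_def
proof (rule k_form_SucI)
  show "k_form 0 (contract v (covec i))" for v
    by (auto simp: k_form_def contract_def covec_def)
qed (auto simp: covec_def intro!: linearI)

lemma k_form_e_form: "k_form (length is) (e_form is)"
proof (induction "is")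
  case Nil
  show ?case by (auto simp: k_form_def)
next
  case (Cons i "is")
  then show ?case using k_form_wedge[OF k_form_covec, of "length is" "e_form is" i] by simp
qed

lemma k_form_vol: "k_form 7 vol"
  using k_form_e_form[of "[1, 2, 3, 4, 5, 6, 7]"] by (simp add: vol_def numeral_eq_Suc del: e_form.simps)

text \<open>For an index set with \<open>k\<close> elements the summand is a multiple of
  \<open>vol\<close> with its first \<open>k\<close> slots fixed; every other summand is
  zero.\<close>

lemma k_form_hodge:
  assumes "k_form k \<alpha>" "k \<le> 7" shows "k_form (7 - k) (\<star>\<alpha>)"
  unfolding hodge_def
proof (rule k_form_sum)
  fix I :: "nat set" assume "I \<in> Pow {1..7}"
  let ?us = "map e_vec (sorted_list_of_set I)"
  show "k_form (7 - k) (\<lambda>ws. \<alpha> ?us * vol (?us @ ws))"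
  proof (cases "length ?us = k")
    case True
    then have "k_form (length ?us + (7 - k)) vol" using assms(2) k_form_vol by simp
    then show ?thesis by (intro k_form_cmult k_form_append)
  next
    case False
    then show ?thesis using assms(1) by (simp add: k_form_degree k_form_zero)
  qed
qed

section \<open>The Chevalley--Eilenberg differential\<close>

text \<open>The Lie derivative of a left-invariant form along the left-invariant field
  \<open>v\<close>. Moving the bracket from slot \<open>j\<close> to the head costs
  \<open>(-1) ^ j\<close>; the remaining minus sign belongs to the Lie derivative itself.\<close>

definition lie_deriv :: "(vec7 \<Rightarrow> vec7 \<Rightarrow> vec7) \<Rightarrow> vec7 \<Rightarrow> form \<Rightarrow> form" where
  "lie_deriv br v \<alpha> = (\<lambda>vs. \<Sum>j<length vs. (-1) ^ Suc j * \<alpha> (br v (vs ! j) # nths vs (- {j})))"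

lemma nths_Cons_Compl_Suc: "nths (v # vs) (- {Suc j}) = v # nths vs (- {j})"
  "nths (v # vs) (- {0, Suc j}) = nths vs (- {j})"
  "nths (v # vs) (- {Suc i, Suc j}) = v # nths vs (- {i, j})"
  "nths (v # vs) (- {0}) = vs"
proof -
  have "{i. Suc i \<in> - {Suc j}} = - {j}" "{i. Suc i \<in> - {0, Suc j}} = - {j}"
    "{k. Suc k \<in> - {Suc i, Suc j}} = - {i, j}" "{j. Suc j \<in> - {0 :: nat}} = UNIV" by auto
  then show "nths (v # vs) (- {Suc j}) = v # nths vs (- {j})"
    "nths (v # vs) (- {0, Suc j}) = nths vs (- {j})"
    "nths (v # vs) (- {Suc i, Suc j}) = v # nths vs (- {i, j})"
    "nths (v # vs) (- {0}) = vs"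
    by (simp_all add: nths_Cons nths_all)
qed

lemma lie_deriv_Nil: "lie_deriv br v \<alpha> [] = 0"
  by (simp add: lie_deriv_def)

lemma lie_deriv_zero: "lie_deriv br v (\<lambda>vs. 0) = (\<lambda>vs. 0)"
  by (simp add: lie_deriv_def)

text \<open>The commutation rule \<iota>_w L_v = L_v \<iota>_w - \<iota>_[v,w].\<close>

lemma lie_deriv_Cons:
  assumes "k_form k \<alpha>"
  shows "lie_deriv br v \<alpha> (w # vs) = lie_deriv br v (contract w \<alpha>) vs - \<alpha> (br v w # vs)"
  by (simp add: lie_deriv_def sum.lessThan_Suc_shift nths_Cons_Compl_Suc contract_def
      k_form_swap[OF assms, of w] sum_negf del: sum.lessThan_Suc)

lemma ce_diff_zero: "ce_diff br (\<lambda>vs. 0) = (\<lambda>vs. 0)"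
  by (simp add: ce_diff_def)

lemma ce_diff_Nil: "ce_diff br \<alpha> [] = 0"
  by (simp add: ce_diff_def)

text \<open>Cartan's formula \<iota>_v d = L_v - d \<iota>_v: the pairs with \<open>i = 0\<close>
  form the Lie derivative, those with \<open>i > 0\<close> the differential of the
  contraction.\<close>

lemma ce_diff_Cons:
  assumes "k_form k \<alpha>"
  shows "ce_diff br \<alpha> (v # vs) = lie_deriv br v \<alpha> vs - ce_diff br (contract v \<alpha>) vs"
proof -
  define n where "n = length vs"
  define P where "P = {(i, j). i < j \<and> j < n}"
  define f where "f = (\<lambda>(i, j). (-1) ^ (i + j)
    * \<alpha> (br ((v # vs) ! i) ((v # vs) ! j) # nths (v # vs) (- {i, j})))"
  have "finite P"
    by (rule finite_subset[of _ "{..<n} \<times> {..<n}"]) (auto simp: P_def)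
  have "{(i, j). i < j \<and> j < Suc n} = (\<lambda>j. (0, Suc j)) ` {..<n} \<union> map_prod Suc Suc ` P" (is "?L = ?R")
  proof (intro equalityI subsetI)
    fix z assume "z \<in> ?L"
    then show "z \<in> ?R"
      by (cases z; cases "fst z"; cases "snd z") (auto simp: P_def)
  qed (auto simp: P_def)
  then have "ce_diff br \<alpha> (v # vs) = sum f ((\<lambda>j. (0, Suc j)) ` {..<n} \<union> map_prod Suc Suc ` P)"
    by (simp add: ce_diff_def f_def n_def)
  also have "\<dots> = sum f ((\<lambda>j. (0, Suc j)) ` {..<n}) + sum f (map_prod Suc Suc ` P)"
    using \<open>finite P\<close> by (intro sum.union_disjoint) auto
  also have "sum f ((\<lambda>j. (0, Suc j)) ` {..<n}) = lie_deriv br v \<alpha> vs"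
    by (subst sum.reindex) (auto simp: inj_on_def f_def lie_deriv_def n_def nths_Cons_Compl_Suc)
  also have "sum f (map_prod Suc Suc ` P) = (\<Sum>(i, j)\<in>P. f (Suc i, Suc j))"
    by (subst sum.reindex) (auto simp: inj_on_def intro!: sum.cong)
  \<comment> \<open>Shifting both indices keeps the sign; the minus comes from swapping the bracket
    with \<open>v\<close>.\<close>
  also have "\<dots> = - ce_diff br (contract v \<alpha>) vs"
    by (simp add: f_def ce_diff_def P_def n_def nths_Cons_Compl_Suc contract_def
      k_form_swap[OF assms, of _ v] case_prod_beta flip: sum_negf)
  finally show ?thesis by simp
qed

lemma k_form_lie_deriv:
  assumes "bilinear br" "k_form k \<alpha>"
  shows "k_form k (lie_deriv br v \<alpha>)"
  using assms(2)
proof (induction k arbitrary: \<alpha>)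
  case 0
  then show ?case by (auto simp: k_form_def lie_deriv_def)
next
  case (Suc k)
  note Cons = lie_deriv_Cons[OF Suc.prems]
  have con: "k_form k (contract w \<alpha>)" for w
    using k_form_contract[OF Suc.prems] by simp
  have lin: "linear (br v)" using assms(1) by (simp add: bilinear_def)
  show ?case
  proof (rule k_form_SucI)
    show "linear (\<lambda>w. lie_deriv br v \<alpha> (w # vs))" for vs
    proof -
      have "linear (\<lambda>w. lie_deriv br v (contract w \<alpha>) vs)"
        unfolding lie_deriv_def contract_def
        by (rule linear_compose_sum, rule ballI,
            rule linear_compose_scale_right[where 'b = real, simplified], rule k_form_linear_head[OF Suc.prems])
      moreover have "linear (\<lambda>w. \<alpha> (br v w # vs))"
        using linear_compose[OF lin k_form_linear_head[OF Suc.prems, of vs]] by (simp add: o_def)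
      ultimately show ?thesis unfolding Cons by (rule linear_compose_sub)
    qed
    show "k_form k (contract w (lie_deriv br v \<alpha>))" for w
    proof -
      have "contract w (lie_deriv br v \<alpha>)
          = (\<lambda>vs. lie_deriv br v (contract w \<alpha>) vs - contract (br v w) \<alpha> vs)"
        by (simp add: fun_eq_iff contract_apply Cons)
      then show ?thesis using Suc.IH[OF con, of w] con[of "br v w"] by (simp add: k_form_diff)
    qed
    \<comment> \<open>The two remaining terms are \<alpha> on \<open>br v w\<close> and
      \<open>w\<close> in both orders.\<close>
    show "lie_deriv br v \<alpha> (w # w # vs) = 0" for w vs
    proof -
      have "contract w (contract w \<alpha>) = (\<lambda>vs. 0)"
        using k_form_alternating[OF Suc.prems] by (auto simp: contract_def)
      then show ?thesis
        using k_form_swap[OF Suc.prems, of w "br v w" vs]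
        by (simp add: Cons lie_deriv_Cons[OF con] lie_deriv_zero contract_apply)
    qed
  qed (rule lie_deriv_Nil)
qed

text \<open>Cartan's formula reduces a contraction of the differential to \<open>lie_deriv\<close>
  and to a differential in lower degree.\<close>

lemma k_form_ce_diff:
  assumes "bilinear br" "\<And>v. br v v = 0" "k_form k \<alpha>"
  shows "k_form (Suc k) (ce_diff br \<alpha>)"
  using assms(3)
proof (induction k arbitrary: \<alpha> rule: less_induct)
  case (less k)
  note Cons = ce_diff_Cons[OF less.prems]
  note con = k_form_contract[OF less.prems]
  have lin: "linear (\<lambda>v. br v x)" for x using assms(1) by (simp add: bilinear_def)
  show ?case
  proof (rule k_form_SucI)
    show "linear (\<lambda>v. ce_diff br \<alpha> (v # vs))" for vs
    proof -
      have "linear (\<lambda>v. \<alpha> (br v x # ws))" for x ws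
        using linear_compose[OF lin k_form_linear_head[OF less.prems, of ws]] by (simp add: o_def)
      then have "linear (\<lambda>v. lie_deriv br v \<alpha> vs)"
        unfolding lie_deriv_def
        by (intro linear_compose_sum ballI linear_compose_scale_right[where 'b = real, simplified])
      moreover have "linear (\<lambda>v. \<alpha> (v # x # ws))" for x ws
        by (rule k_form_linear_head[OF less.prems])
      then have "linear (\<lambda>v. ce_diff br (contract v \<alpha>) vs)"
        unfolding ce_diff_def contract_def case_prod_beta
        by (intro linear_compose_sum ballI linear_compose_scale_right[where 'b = real, simplified])
      ultimately show ?thesis unfolding Cons by (rule linear_compose_sub)
    qed
    show "k_form k (contract v (ce_diff br \<alpha>))" for v
    proof -
      have "k_form k (ce_diff br (contract v \<alpha>))"
      proof (cases k)
        case 0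
        then show ?thesis using less.prems by (simp add: contract_0_form ce_diff_zero k_form_zero)
      next
        case (Suc n)
        then show ?thesis using less.IH[of n "contract v \<alpha>"] con by simp
      qed
      then show ?thesis
        using k_form_lie_deriv[OF assms(1) less.prems, of v]
        by (simp add: contract_def[of v "ce_diff _ _"] Cons k_form_diff)
    qed
    \<comment> \<open>The two Lie derivatives of \<open>contract v \<alpha>\<close> cancel; the
      other terms contain \<open>br v v\<close> or a double contraction with
      \<open>v\<close>.\<close>
    show "ce_diff br \<alpha> (v # v # vs) = 0" for v vs
    proof -
      have "contract v (contract v \<alpha>) = (\<lambda>vs. 0)"
        using k_form_alternating[OF less.prems] by (auto simp: contract_def)
      then show ?thesis
        by (simp add: Cons ce_diff_Cons[OF con] lie_deriv_Cons[OF less.prems] assms(2)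
            linear_0[OF k_form_linear_head[OF less.prems]] ce_diff_zero)
    qed
  qed (rule ce_diff_Nil)
qed

section \<open>Forms on the standard basis\<close>

text \<open>Lets increasing index lists be enumerated by \<open>subseqs\<close>, which the
  simplifier can unfold.\<close>

lemma sorted_mem_subseqs:
  "sorted_wrt (<) xs \<Longrightarrow> sorted_wrt (<) ys \<Longrightarrow> set xs \<subseteq> set ys \<Longrightarrow> xs \<in> set (subseqs ys)"
  for xs ys :: "'a::linorder list"
proof (induction ys arbitrary: xs)
  case (Cons y ys)
  show ?case
  proof (cases "y \<in> set xs")
    case True
    then obtain x xs' where xs: "xs = x # xs'" by (cases xs) auto
    have "x = y" using True Cons.prems by (fastforce simp: xs)
    then have "xs' \<in> set (subseqs ys)"
      using Cons.prems by (intro Cons.IH) (auto simp: xs)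
    then show ?thesis by (simp add: xs \<open>x = y\<close> Let_def)
  next
    case False
    then have "xs \<in> set (subseqs ys)"
      using Cons.prems by (intro Cons.IH) auto
    then show ?thesis by (simp add: Let_def)
  qed
qed simp

lemma e_vec_expansion: "v = (\<Sum>i\<in>{1..7}. (v $ of_nat i) *\<^sub>R e_vec i)"
proof -
  have "{1..7} = {1, 2, 3, 4, 5, 6, 7 :: nat}" by auto
  then show ?thesis by (intro vec7_eqI) simp_all
qed

text \<open>Reordering arguments changes a value only by a sign. Absolute values suffice to transfer
  vanishing and avoid tracking that sign.\<close>

lemma form_abs_insort:
  assumes "k_form k \<alpha>"
  shows "\<bar>\<alpha> (map f (insort i is))\<bar> = \<bar>\<alpha> (f i # map f is)\<bar>"
  using assms
proof (induction "is" arbitrary: k \<alpha>)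
  case (Cons j js)
  show ?case
    using Cons.IH[OF k_form_contract[OF Cons.prems], of "f j"] k_form_swap[OF Cons.prems, of "f i" "f j"]
    by (simp add: contract_def)
qed simp

lemma form_abs_sort:
  assumes "k_form k \<alpha>"
  shows "\<bar>\<alpha> (map f (sort is))\<bar> = \<bar>\<alpha> (map f is)\<bar>"
  using assms
proof (induction "is" arbitrary: k \<alpha>)
  case (Cons i js)
  show ?case
    using Cons.IH[OF k_form_contract[OF Cons.prems], of "f i"] form_abs_insort[OF Cons.prems, of f i "sort js"]
    by (simp add: contract_def)
qed simp

lemma k_form_eq_0I:
  assumes "k_form k \<alpha>"
    and "\<And>is. set is \<subseteq> {1..7} \<Longrightarrow> \<alpha> (map e_vec is) = 0"
  shows "\<alpha> vs = 0"
  using assms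
proof (induction vs arbitrary: k \<alpha>)
  case Nil
  then show ?case using Nil.prems(2)[of "[]"] by simp
next
  case (Cons v vs)
  have "\<alpha> (e_vec i # vs) = 0" if "i \<in> {1..7}" for i
  proof -
    have "contract (e_vec i) \<alpha> vs = 0"
      using that by (intro Cons.IH[OF k_form_contract[OF Cons.prems(1)]])
        (simp add: contract_def Cons.prems(2)[of "i # _", simplified])
    then show ?thesis by (simp add: contract_def)
  qed
  moreover note lin = k_form_linear_head[OF Cons.prems(1), of vs]
  ultimately have "\<alpha> ((\<Sum>i\<in>{1..7}. (v $ of_nat i) *\<^sub>R e_vec i) # vs) = 0"
    by (simp add: linear_sum[OF lin] linear_cmul[OF lin])
  then show ?case by (simp only: e_vec_expansion[symmetric])
qed

text \<open>Turns an identity between forms into a finite check that the simplifier can carry out: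
  multilinearity reduces to basis vectors, alternation to increasing indices.\<close>

lemma k_form_eqI:
  assumes "k_form k \<alpha>" "k_form k \<beta>"
    and "\<forall>is\<in>set (filter (\<lambda>is. length is = k) (subseqs [1, 2, 3, 4, 5, 6, 7])).
      \<alpha> (map e_vec is) = \<beta> (map e_vec is)"
  shows "\<alpha> = \<beta>"
proof
  fix vs
  let ?\<gamma> = "\<lambda>vs. \<alpha> vs - \<beta> vs"
  have \<gamma>: "k_form k ?\<gamma>" by (rule k_form_diff[OF assms(1,2)])
  have "?\<gamma> (map e_vec is) = 0" if "set is \<subseteq> {1..7}" for "is"
  proof (cases "distinct is \<and> length is = k")
    case True
    have "{1..7} = {1, 2, 3, 4, 5, 6, 7 :: nat}" by auto
    then have "set is \<subseteq> {1, 2, 3, 4, 5, 6, 7}" using that by simp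
    then have "sort is \<in> set (subseqs [1, 2, 3, 4, 5, 6, 7])"
      using True by (intro sorted_mem_subseqs) (auto simp: strict_sorted_iff)
    then have "?\<gamma> (map e_vec (sort is)) = 0"
      using True assms(3) by (simp del: subseqs.simps)
    then show ?thesis using form_abs_sort[OF \<gamma>, of e_vec "is"] by simp
  next
    case False
    then show ?thesis
      using k_form_not_distinct[OF \<gamma>, of "map e_vec is"] k_form_degree[OF \<gamma>, of "map e_vec is"]
      by (auto simp: distinct_map)
  qed
  then show "\<alpha> vs = \<beta> vs" using k_form_eq_0I[OF \<gamma>] by simp
qed

text \<open>Only the complement of \<open>js\<close> contributes: an index set meeting
  \<open>js\<close> repeats an argument of \<open>vol\<close>, and any other set has too few
  elements.\<close>

lemma hodge_basis:
  assumes "distinct js" "set js \<subseteq> {1..7}"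
  defines "ks \<equiv> filter (\<lambda>k. k \<notin> set js) [1, 2, 3, 4, 5, 6, 7]"
  shows "(\<star>\<alpha>) (map e_vec js) = \<alpha> (map e_vec ks) * vol (map e_vec (ks @ js))"
proof -
  let ?K = "{1..7} - set js"
  have set7: "{1..7} = {1, 2, 3, 4, 5, 6, 7 :: nat}" by auto
  have "?K = set ks" unfolding ks_def set_filter set7 by fastforce
  moreover have "sorted ks" "distinct ks"
    unfolding ks_def by (rule sorted_wrt_filter distinct_filter, simp)+
  ultimately have ks: "sorted_list_of_set ?K = ks"
    using sorted_list_of_set.idem_if_sorted_distinct[of ks] by simp
  have zero: "vol (map e_vec (sorted_list_of_set I) @ map e_vec js) = 0"
    if I: "I \<subseteq> {1..7}" "I \<noteq> ?K" for I
  proof -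
    have fin: "finite I" using I(1) finite_subset by blast
    show ?thesis
    proof (cases "I \<inter> set js = {}")
      case True
      have "I \<subset> ?K" using I True by auto
      then have "card I < card ?K" by (intro psubset_card_mono) auto
      also have "card ?K = 7 - length js"
        using assms(1,2) by (simp add: card_Diff_subset distinct_card)
      finally show ?thesis using fin by (intro k_form_degree[OF k_form_vol]) auto
    next
      case False
      then show ?thesis using fin by (intro k_form_not_distinct[OF k_form_vol]) auto
    qed
  qed
  let ?f = "\<lambda>I. \<alpha> (map e_vec (sorted_list_of_set I))
    * vol (map e_vec (sorted_list_of_set I) @ map e_vec js)"
  have "(\<star>\<alpha>) (map e_vec js) = sum ?f (Pow {1..7})"
    by (simp only: hodge_def)
  also have "\<dots> = sum ?f {?K}"
    using zero by (intro sum.mono_neutral_right) auto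
  also have "\<dots> = \<alpha> (map e_vec ks) * vol (map e_vec (ks @ js))"
    by (simp add: ks del: One_nat_def)
  finally show ?thesis .
qed

section \<open>Evaluation of wedge products and Hodge stars on basis vectors\<close>

lemma wedge_1_Cons:
  assumes "k_form (Suc 0) \<alpha>"
  shows "(\<alpha> \<curlywedge> \<beta>) [] = 0" "(\<alpha> \<curlywedge> \<beta>) (v # vs) = \<alpha> [v] * \<beta> vs - (\<alpha> \<curlywedge> contract v \<beta>) vs"
proof -
  have "contract v \<alpha> = (\<lambda>vs. if vs = [] then \<alpha> [v] else 0)"
    using assms by (auto simp: contract_def k_form_def)
  then show "(\<alpha> \<curlywedge> \<beta>) (v # vs) = \<alpha> [v] * \<beta> vs - (\<alpha> \<curlywedge> contract v \<beta>) vs"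
    by (subst wedge_Cons[OF k_form_degree[OF assms]]) (auto simp: scalar_wedge)
qed (use assms in \<open>simp add: wedge_Nil k_form_def\<close>)

lemma wedge_2_Cons:
  assumes "k_form 2 \<alpha>"
  shows "(\<alpha> \<curlywedge> \<beta>) [] = 0" "(\<alpha> \<curlywedge> \<beta>) (v # vs) = (contract v \<alpha> \<curlywedge> \<beta>) vs + (\<alpha> \<curlywedge> contract v \<beta>) vs"
  using assms by (simp_all add: wedge_Nil k_form_def wedge_Cons[where p = 2])

lemma wedge_3_Cons:
  assumes "k_form 3 \<alpha>"
  shows "(\<alpha> \<curlywedge> \<beta>) [] = 0" "(\<alpha> \<curlywedge> \<beta>) (v # vs) = (contract v \<alpha> \<curlywedge> \<beta>) vs - (\<alpha> \<curlywedge> contract v \<beta>) vs"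
  using assms by (simp_all add: wedge_Nil k_form_def wedge_Cons[where p = 3])

lemma k_form_contract_2_3:
  "k_form 2 \<alpha> \<Longrightarrow> k_form (Suc 0) (contract v \<alpha>)" "k_form 3 \<alpha> \<Longrightarrow> k_form 2 (contract v \<alpha>)"
  using k_form_contract[of 2 \<alpha> v] k_form_contract[of 3 \<alpha> v] by simp_all

lemmas wedge_eval = wedge_1_Cons wedge_2_Cons wedge_3_Cons k_form_contract_2_3 contract_apply

text \<open>
  Unlike \<open>covec_wedge_Cons\<close>, these rules let the simplifier discard the branches with coefficient
  \<open>0\<close> before it evaluates them; otherwise the evaluation of \<open>e_form\<close> takes factorial time.
\<close>

lemma covec_wedge_basis:
  assumes "Suc 0 \<le> i" "i \<le> 7" "Suc 0 \<le> j" "j \<le> 7"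
  shows "i = j \<Longrightarrow> (covec i \<curlywedge> \<beta>) (e_vec j # vs) = \<beta> vs - (covec i \<curlywedge> contract (e_vec j) \<beta>) vs"
    and "i \<noteq> j \<Longrightarrow> (covec i \<curlywedge> \<beta>) (e_vec j # vs) = - (covec i \<curlywedge> contract (e_vec j) \<beta>) vs"
proof -
  have "i \<in> {1, 2, 3, 4, 5, 6, 7}" "j \<in> {1, 2, 3, 4, 5, 6, 7}" using assms by auto
  then have "e_vec j $ of_nat i = (if i = j then 1 else 0)"
    by auto
  then show "i = j \<Longrightarrow> (covec i \<curlywedge> \<beta>) (e_vec j # vs) = \<beta> vs - (covec i \<curlywedge> contract (e_vec j) \<beta>) vs"
    "i \<noteq> j \<Longrightarrow> (covec i \<curlywedge> \<beta>) (e_vec j # vs) = - (covec i \<curlywedge> contract (e_vec j) \<beta>) vs"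
    by (simp_all add: covec_wedge_Cons)
qed

lemmas e_form_basis = covec_wedge_Nil covec_wedge_basis contract_apply

lemma hodge_basis_Nil: "(\<star>\<alpha>) [] = \<alpha> (map e_vec [1, 2, 3, 4, 5, 6, 7])"
  using hodge_basis[of "[]" \<alpha>] by (simp add: vol_def e_form_basis)

text \<open>Lengths 2, 4 and 5 serve the stars of 5-forms, 3-forms and 2-forms; unfolding
  \<open>map\<close> makes the left-hand sides match explicit argument lists.\<close>

lemmas hodge_eval = hodge_basis_Nil hodge_basis[of "[i, j]" for i j, unfolded list.map]
  hodge_basis[of "[i, j, k, l]" for i j k l, unfolded list.map]
  hodge_basis[of "[i, j, k, l, m]" for i j k l m, unfolded list.map]
  vol_def e_form_basis

section \<open>The decomposition of 4-forms defined by \<open>phi\<close>\<close>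

lemma k_form_e_formI: "length is = k \<Longrightarrow> k_form k (e_form is)"
  using k_form_e_form by blast

lemma k_form_phi: "k_form 3 phi"
  unfolding phi_def by (intro k_form_add k_form_diff k_form_e_formI) simp_all

lemma k_form_star_phi: "k_form 4 (\<star>phi)"
  using k_form_hodge[OF k_form_phi] by simp

text \<open>Independence of the G_2-components of dimensions 1, 7 and 27 in the space of
  4-forms.\<close>

lemma phi_decomposition_unique:
  assumes "k_form 1 \<sigma>1" "k_form 3 \<sigma>3" "\<sigma>3 \<curlywedge> phi = (\<lambda>vs. 0)" "\<sigma>3 \<curlywedge> \<star>phi = (\<lambda>vs. 0)"
    and "\<And>vs. s0 * (\<star>phi) vs + 3 * (\<sigma>1 \<curlywedge> phi) vs + (\<star>\<sigma>3) vs = 0"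
  shows "s0 = 0" "\<sigma>1 = (\<lambda>vs. 0)" "\<sigma>3 = (\<lambda>vs. 0)"
proof -
  have \<sigma>1: "k_form (Suc 0) \<sigma>1" using assms(1) by simp
  note [simp] = hodge_eval wedge_eval \<sigma>1 assms(2) phi_basis
  have "\<forall>is\<in>set (filter (\<lambda>is. length is = 4) (subseqs [1, 2, 3, 4, 5, 6, 7])).
     s0 * (\<star>phi) (map e_vec is) + 3 * (\<sigma>1 \<curlywedge> phi) (map e_vec is) + (\<star>\<sigma>3) (map e_vec is) = 0"
    using assms(5) by blast
  note eqs = this[simplified]
  have "(\<sigma>3 \<curlywedge> \<star>phi) (map e_vec [1, 2, 3, 4, 5, 6, 7]) = 0"
    by (simp only: assms(4))
  note eq7 = this[simplified]
  have "\<forall>is\<in>set (filter (\<lambda>is. length is = 6) (subseqs [1, 2, 3, 4, 5, 6, 7])).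
     (\<sigma>3 \<curlywedge> phi) (map e_vec is) = 0"
    using fun_cong[OF assms(3)] by blast
  note eq6 = this[simplified]
  \<comment> \<open>A suitable combination is the pairing with \<open>\<star>phi\<close>: it gives 7
    times \<open>s0\<close>, since the \<sigma>1 term drops out by phi wedge phi = 0 and the
    \<sigma>3 term by \<open>eq7\<close>.\<close>
  show "s0 = 0" using eqs eq7 by linarith
  \<comment> \<open>Likewise, pairing with e^i wedge phi leaves 12 times \<sigma>1(e_i), because
    \<open>eq6\<close> removes the \<sigma>3 term.\<close>
  have "\<sigma>1 [e_vec (Suc 0)] = 0" "\<sigma>1 [e_vec 2] = 0" "\<sigma>1 [e_vec 3] = 0" "\<sigma>1 [e_vec 4] = 0"
    "\<sigma>1 [e_vec 5] = 0" "\<sigma>1 [e_vec 6] = 0" "\<sigma>1 [e_vec 7] = 0"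
    using eqs eq6 by linarith+
  then show \<sigma>1_eq: "\<sigma>1 = (\<lambda>vs. 0)"
    by (intro k_form_eqI[OF assms(1) k_form_zero]) simp
  \<comment> \<open>What remains says \<open>\<star>\<sigma>3 = 0\<close>, and its components are
    those of \<sigma>3 up to sign.\<close>
  show "\<sigma>3 = (\<lambda>vs. 0)"
    using eqs \<open>s0 = 0\<close> unfolding \<sigma>1_eq
    by (intro k_form_eqI[OF assms(2) k_form_zero]) simp
qed

section \<open>Torsion forms\<close>

lemma hodge_diff: "(\<star>(\<lambda>vs. \<alpha> vs - \<beta> vs)) ws = (\<star>\<alpha>) ws - (\<star>\<beta>) ws"
  by (simp add: hodge_def algebra_simps sum_subtractf)

lemma hodge_2_form_eq_0:
  assumes "k_form 2 \<alpha>" "\<star>\<alpha> = (\<lambda>vs. 0)"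
  shows "\<alpha> = (\<lambda>vs. 0)"
proof -
  note [simp] = hodge_eval
  have "\<forall>is\<in>set (filter (\<lambda>is. length is = 5) (subseqs [1, 2, 3, 4, 5, 6, 7])). (\<star>\<alpha>) (map e_vec is) = 0"
    using fun_cong[OF assms(2)] by blast
  note eqs = this[simplified]
  show ?thesis
    using eqs by (intro k_form_eqI[OF assms(1) k_form_zero]) simp
qed

text \<open>All conditions are linear, so the differences solve the homogeneous equation for
  \<open>phi\<close>. Once the 1-forms agree, the equation for \<open>\<star>phi\<close> leaves only
  the star of the difference of the 2-forms.\<close>

lemma torsion_forms_unique:
  assumes s: "torsion_forms br phi s0 s1 s2 s3" and t: "torsion_forms br phi t0 t1 t2 t3"
  shows "s0 = t0" "s1 = t1" "s2 = t2" "s3 = t3"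
proof -
  let ?d1 = "\<lambda>vs. s1 vs - t1 vs" and ?d2 = "\<lambda>vs. s2 vs - t2 vs" and ?d3 = "\<lambda>vs. s3 vs - t3 vs"
  have d: "k_form 1 ?d1" "k_form 2 ?d2" "k_form 3 ?d3"
    using s t unfolding torsion_forms_def by (blast intro: k_form_diff)+
  have "s3 \<curlywedge> phi = (\<lambda>vs. 0)" "t3 \<curlywedge> phi = (\<lambda>vs. 0)"
    "s3 \<curlywedge> \<star>phi = (\<lambda>vs. 0)" "t3 \<curlywedge> \<star>phi = (\<lambda>vs. 0)"
    using s t unfolding torsion_forms_def by blast+
  then have "?d3 \<curlywedge> phi = (\<lambda>vs. 0)" "?d3 \<curlywedge> \<star>phi = (\<lambda>vs. 0)"
    by (simp_all add: fun_eq_iff wedge_diff_left)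
  moreover have "(s0 - t0) * (\<star>phi) vs + 3 * (?d1 \<curlywedge> phi) vs + (\<star>?d3) vs = 0" for vs
  proof -
    have "ce_diff br phi vs = s0 * (\<star>phi) vs + 3 * (s1 \<curlywedge> phi) vs + (\<star>s3) vs"
      "ce_diff br phi vs = t0 * (\<star>phi) vs + 3 * (t1 \<curlywedge> phi) vs + (\<star>t3) vs"
      using s t unfolding torsion_forms_def by (auto dest: fun_cong[of _ _ vs])
    then show ?thesis by (simp add: wedge_diff_left hodge_diff algebra_simps)
  qed
  ultimately have eq: "s0 - t0 = 0" "?d1 = (\<lambda>vs. 0)" "?d3 = (\<lambda>vs. 0)"
    using phi_decomposition_unique[OF d(1,3)] by blast+
  show "s0 = t0" "s1 = t1" "s3 = t3"
    using eq(1) fun_cong[OF eq(2)] fun_cong[OF eq(3)] by auto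
  have "(\<star>?d2) vs = 0" for vs
  proof -
    have "ce_diff br (\<star>phi) vs = 4 * (s1 \<curlywedge> \<star>phi) vs + (\<star>s2) vs"
      "ce_diff br (\<star>phi) vs = 4 * (t1 \<curlywedge> \<star>phi) vs + (\<star>t2) vs"
      using s t unfolding torsion_forms_def by (auto dest: fun_cong[of _ _ vs])
    then show ?thesis by (simp add: \<open>s1 = t1\<close> hodge_diff)
  qed
  then have "\<star>?d2 = (\<lambda>vs. 0)" by (rule ext)
  then have "?d2 = (\<lambda>vs. 0)"
    by (rule hodge_2_form_eq_0[OF d(2)])
  from fun_cong[OF this] show "s2 = t2" by auto
qed

text \<open>Write w2 = e^46 - e^57 and w3 = e^47 + e^56. The brackets give d phi = (a + b) (e^12 w3
  + e^13 w2) + (c + d) e^23 w2 and d \<star>phi = (c + d) e^123 w3. Pairing d phi with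
  \<open>\<star>phi\<close> yields -4 (a + b), which is 7 times this scalar.\<close>

definition g_tau0 :: "real \<Rightarrow> real \<Rightarrow> real" where
  "g_tau0 a b = - 4 / 7 * (a + b)"

text \<open>Pairing d \<star>phi with e^3 wedge \<open>\<star>phi\<close>, whose squared length is
  3, yields -2 (c + d), which is 12 times the coefficient.\<close>

definition g_tau1 :: "real \<Rightarrow> real \<Rightarrow> form" where
  "g_tau1 c d = (\<lambda>vs. - (c + d) / 6 * e_form [3] vs)"

text \<open>\<open>g_tau2\<close> and \<open>g_tau3\<close> are the remainders: their stars are d
  \<star>phi and d phi minus the terms in \<open>g_tau0\<close> and \<open>g_tau1\<close>.\<close>

definition g_tau2 :: "real \<Rightarrow> real \<Rightarrow> form" where
  "g_tau2 c d = (\<lambda>vs. (c + d) / 3 * (2 * e_form [1,2] vs + e_form [4,7] vs + e_form [5,6] vs))"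

definition g_tau3 :: "real \<Rightarrow> real \<Rightarrow> real \<Rightarrow> real \<Rightarrow> form" where
  "g_tau3 a b c d = (\<lambda>vs.
     (a + b) / 7 * (4 * (e_form [1,2,3] vs + e_form [1,4,5] vs + e_form [1,6,7] vs)
       - 3 * (e_form [2,4,6] vs - e_form [2,5,7] vs - e_form [3,4,7] vs - e_form [3,5,6] vs))
   + (c + d) / 2 * (e_form [1,4,6] vs - e_form [1,5,7] vs + e_form [2,4,5] vs + e_form [2,6,7] vs))"

lemma k_form_g_tau:
  "k_form 1 (g_tau1 c d)" "k_form 2 (g_tau2 c d)" "k_form 3 (g_tau3 a b c d)"
  unfolding g_tau1_def g_tau2_def g_tau3_def
  by (intro k_form_add k_form_diff k_form_cmult k_form_e_formI; simp)+

lemma g_tau_eval: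
  "g_tau1 c d [u] = - (c + d) / 6 * e_form [3] [u]"
  "g_tau2 c d [u, v] = (c + d) / 3 * (2 * e_form [1,2] [u, v] + e_form [4,7] [u, v] + e_form [5,6] [u, v])"
  "g_tau3 a b c d [u, v, w] =
     (a + b) / 7 * (4 * (e_form [1,2,3] [u, v, w] + e_form [1,4,5] [u, v, w] + e_form [1,6,7] [u, v, w])
       - 3 * (e_form [2,4,6] [u, v, w] - e_form [2,5,7] [u, v, w]
           - e_form [3,4,7] [u, v, w] - e_form [3,5,6] [u, v, w]))
   + (c + d) / 2 * (e_form [1,4,6] [u, v, w] - e_form [1,5,7] [u, v, w]
       + e_form [2,4,5] [u, v, w] + e_form [2,6,7] [u, v, w])"
  by (simp_all only: g_tau1_def g_tau2_def g_tau3_def)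

text \<open>Nested initial segments can be expanded by the simplifier for explicit argument lists,
  unlike the set of pairs.\<close>

lemma ce_diff_nested_sum:
  "ce_diff br \<alpha> vs = (\<Sum>j<length vs. \<Sum>i<j.
     (-1) ^ (i + j) * \<alpha> (br (vs ! i) (vs ! j) # nths vs (- {i, j})))"
  unfolding ce_diff_def
  by (subst sum.Sigma)
    (auto intro!: sum.reindex_bij_witness[where i = prod.swap and j = prod.swap])

lemma ce_diff_4:
  "ce_diff br \<alpha> [u, v, w, x] =
     - \<alpha> [br u v, w, x] + \<alpha> [br u w, v, x] - \<alpha> [br u x, v, w]
     - \<alpha> [br v w, u, x] + \<alpha> [br v x, u, w] - \<alpha> [br w x, u, v]"
  by (simp add: ce_diff_nested_sum nths_Cons)

lemma ce_diff_5:
  "ce_diff br \<alpha> [u, v, w, x, y] =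
     - \<alpha> [br u v, w, x, y] + \<alpha> [br u w, v, x, y] - \<alpha> [br u x, v, w, y] + \<alpha> [br u y, v, w, x]
     - \<alpha> [br v w, u, x, y] + \<alpha> [br v x, u, w, y] - \<alpha> [br v y, u, w, x]
     - \<alpha> [br w x, u, v, y] + \<alpha> [br w y, u, v, x] - \<alpha> [br x y, u, v, w]"
  by (simp add: ce_diff_nested_sum nths_Cons)

lemma k_form_head_scale:
  assumes "k_form k \<alpha>"
  shows "\<alpha> ((r *\<^sub>R v) # vs) = r * \<alpha> (v # vs)" "\<alpha> ((- v) # vs) = - \<alpha> (v # vs)" "\<alpha> (0 # vs) = 0"
  using linear_cmul[OF k_form_linear_head[OF assms], of r v vs]
    linear_neg[OF k_form_linear_head[OF assms], of v vs]
    linear_0[OF k_form_linear_head[OF assms], of vs] by simp_all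

text \<open>Each identity equates forms of a known degree, so \<open>k_form_eqI\<close> leaves
  finitely many values on basis vectors.\<close>

lemma torsion_forms_g:
  "torsion_forms (g_bracket a b c d) phi (g_tau0 a b) (g_tau1 c d) (g_tau2 c d) (g_tau3 a b c d)"
proof -
  note [simp] = k_form_g_tau(2)[of c d] k_form_g_tau(3)[of a b c d] k_form_g_tau(1)[of c d, unfolded One_nat_def]
    hodge_eval wedge_eval phi_basis g_bracket_basis[unfolded One_nat_def] ce_diff_4 ce_diff_5
    k_form_head_scale[OF k_form_phi] k_form_head_scale[OF k_form_star_phi]
    k_form_not_distinct[OF k_form_phi] k_form_not_distinct[OF k_form_star_phi]
  \<comment> \<open>The first \<open>simp\<close> of each pair reduces to few values of the opaque torsion forms; expanding
    the torsion forms at once would evaluate them at every shuffle.\<close>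
  show ?thesis
    unfolding torsion_forms_def
  proof (intro conjI)
    show "g_tau2 c d \<curlywedge> \<star>phi = (\<lambda>vs. 0)"
      using k_form_wedge[OF k_form_g_tau(2) k_form_star_phi]
      by (rule k_form_eqI[OF _ k_form_zero]) (simp, simp add: g_tau_eval)
    show "g_tau3 a b c d \<curlywedge> phi = (\<lambda>vs. 0)"
      using k_form_wedge[OF k_form_g_tau(3) k_form_phi]
      by (rule k_form_eqI[OF _ k_form_zero]) (simp, simp add: g_tau_eval)
    show "g_tau3 a b c d \<curlywedge> \<star>phi = (\<lambda>vs. 0)"
      using k_form_wedge[OF k_form_g_tau(3) k_form_star_phi]
      by (rule k_form_eqI[OF _ k_form_zero]) (simp, simp add: g_tau_eval field_simps)
    show "ce_diff (g_bracket a b c d) phi = (\<lambda>vs. g_tau0 a b * (\<star>phi) vs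
      + 3 * (g_tau1 c d \<curlywedge> phi) vs + (\<star>g_tau3 a b c d) vs)" (is "_ = ?\<beta>")
    proof (rule k_form_eqI)
      show "k_form 4 (ce_diff (g_bracket a b c d) phi)"
        using k_form_ce_diff[OF g_bracket_lie(1,2) k_form_phi, of a b c d] by simp
      show "k_form 4 ?\<beta>"
        using k_form_hodge[OF k_form_g_tau(3)] k_form_wedge[OF k_form_g_tau(1) k_form_phi]
        by (intro k_form_add k_form_cmult k_form_star_phi) simp_all
    qed (simp, simp add: g_tau_eval g_tau0_def field_simps)
    show "ce_diff (g_bracket a b c d) (\<star>phi) = (\<lambda>vs. 4 * (g_tau1 c d \<curlywedge> \<star>phi) vs + (\<star>g_tau2 c d) vs)"
      (is "_ = ?\<beta>")
    proof (rule k_form_eqI)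
      show "k_form 5 (ce_diff (g_bracket a b c d) (\<star>phi))"
        using k_form_ce_diff[OF g_bracket_lie(1,2) k_form_star_phi, of a b c d] by simp
      show "k_form 5 ?\<beta>"
        using k_form_hodge[OF k_form_g_tau(2)] k_form_wedge[OF k_form_g_tau(1) k_form_star_phi]
        by (intro k_form_add k_form_cmult) simp_all
    qed (simp, simp add: g_tau_eval field_simps)
  qed (rule k_form_g_tau)+
qed

section \<open>The Levi-Civita connection and the divergence\<close>

text \<open>The Koszul argument: for the difference \<open>E\<close>, the expression
  \<open>E x y \<bullet> z\<close> is symmetric in the first two and skew in the last two arguments;
  alternating the two rules three times returns its negative.\<close>

lemma is_levi_civita_unique:
  assumes "is_levi_civita br D" "is_levi_civita br D'"
  shows "D = D'"
proof -
  define E where "E x y = D x y - D' x y" for x y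
  have sym: "E x y = E y x" for x y
  proof -
    have "D x y - D y x = br x y" "D' x y - D' y x = br x y"
      using assms unfolding is_levi_civita_def by blast+
    then have "D x y - D y x = D' x y - D' y x" by simp
    then show ?thesis by (simp add: E_def algebra_simps)
  qed
  have skew: "E x y \<bullet> z = - (E x z \<bullet> y)" for x y z
  proof -
    have "D x y \<bullet> z + y \<bullet> D x z = 0" "D' x y \<bullet> z + y \<bullet> D' x z = 0"
      using assms unfolding is_levi_civita_def by blast+
    then show ?thesis by (simp add: E_def inner_diff_left inner_commute[of y])
  qed
  have "E x y \<bullet> z = 0" for x y z
    using skew[of x y z] skew[of z x y] skew[of y z x]
    unfolding sym[of z x] sym[of z y] sym[of y x] by linarith
  then have "E x y = 0" for x y using inner_eq_zero_iff by blast
  then show ?thesis by (simp add: E_def fun_eq_iff)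
qed

lemma levi_civita_g:
  "levi_civita (g_bracket a b c d) x y = g_bracket a b c d (x $ 1 *\<^sub>R e_vec 1 + x $ 2 *\<^sub>R e_vec 2) y"
proof -
  let ?D = "\<lambda>x y. g_bracket a b c d (x $ 1 *\<^sub>R e_vec 1 + x $ 2 *\<^sub>R e_vec 2) y"
  \<comment> \<open>Torsion-freeness holds because e_1 and e_2 commute and e_3, ..., e_7 commute
    with each other.\<close>
  have "is_levi_civita (g_bracket a b c d) ?D"
    unfolding is_levi_civita_def bilinear_def
    by (intro conjI allI linearI vec7_eqI)
      (simp_all add: g_bracket_def inner_vec7 algebra_simps)
  then have "levi_civita (g_bracket a b c d) = ?D"
    unfolding levi_civita_def by (intro the_equality is_levi_civita_unique)
  then show ?thesis by simp
qed

text \<open>ad e_1 and ad e_2 annihilate e_1, e_2, e_3 and act as multiples of quarter turns on the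
  planes of e_4, e_5 and of e_6, e_7.\<close>

lemma levi_civita_g_basis:
  assumes "i \<in> {1..7}" "j \<in> {1..7}"
  obtains "levi_civita (g_bracket a b c d) (e_vec i) (e_vec j) = 0"
  | r k where "i \<in> {1, 2}" "k \<in> {4, 5, 6, 7}"
      "levi_civita (g_bracket a b c d) (e_vec i) (e_vec j) = r *\<^sub>R e_vec k"
proof -
  let ?D = "levi_civita (g_bracket a b c d) (e_vec i) (e_vec j)"
  have i: "i \<in> {1, 2} \<or> i \<in> {3, 4, 5, 6, 7}" and j: "j \<in> {1, 2, 3, 4, 5, 6, 7}"
    using assms by auto
  show thesis
  proof (cases "i \<in> {3, 4, 5, 6, 7} \<or> j \<in> {1, 2, 3}")
    case True
    then have "?D = 0"
      using i j by (elim disjE insertE emptyE) (simp_all add: levi_civita_g g_bracket_def)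
    then show thesis by (rule that(1))
  next
    case False
    \<comment> \<open>The partner of \<open>j\<close> in its plane.\<close>
    define k where "k = (if j = 4 then 5 else if j = 5 then 4 else if j = 6 then 7 else 6 :: nat)"
    have "\<exists>r. ?D = r *\<^sub>R e_vec k"
    proof
      have "i \<in> {1, 2}" "j \<in> {4, 5, 6, 7}" using False i j by auto
      then show "?D = (?D $ of_nat k) *\<^sub>R e_vec k"
        by (elim insertE emptyE) (simp_all add: k_def levi_civita_g g_bracket_def)
    qed
    then show thesis using that(2)[of k] False i by (auto simp: k_def split: if_splits)
  qed
qed

lemma levi_civita_g_diag:
  "i \<in> {1..7} \<Longrightarrow> levi_civita (g_bracket a b c d) (e_vec i) (e_vec i) = 0"
proof -
  assume "i \<in> {1..7}"
  then have "i \<in> {1, 2, 3, 4, 5, 6, 7}" by auto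
  then show ?thesis by (elim insertE emptyE) (simp_all add: levi_civita_g g_bracket_def)
qed

section \<open>Entries of the full torsion tensor\<close>

lemma full_torsion_eq:
  assumes "torsion_forms br phi \<tau>0 \<tau>1 \<tau>2 \<tau>3"
  shows "full_torsion br phi v w =
    \<tau>0 / 4 * (v \<bullet> w) - (\<star>(\<tau>1 \<curlywedge> \<star>phi)) [v, w] - 1 / 2 * \<tau>2 [v, w] - 1 / 4 * j_map phi \<tau>3 v w"
proof -
  \<comment> \<open>By uniqueness, the definite description equals any known solution.\<close>
  have "(THE (\<tau>0, \<tau>1, \<tau>2, \<tau>3). torsion_forms br phi \<tau>0 \<tau>1 \<tau>2 \<tau>3) = (\<tau>0, \<tau>1, \<tau>2, \<tau>3)"
  proof (rule the_equality)
    show "x = (\<tau>0, \<tau>1, \<tau>2, \<tau>3)"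
      if "case x of (\<tau>0, \<tau>1, \<tau>2, \<tau>3) \<Rightarrow> torsion_forms br phi \<tau>0 \<tau>1 \<tau>2 \<tau>3" for x
    proof (cases x)
      case (fields s0 s1 s2 s3)
      then have "torsion_forms br phi s0 s1 s2 s3" using that by simp
      from torsion_forms_unique[OF this assms] show ?thesis using fields by simp
    qed
  qed (use assms in simp)
  then show ?thesis by (simp add: full_torsion_def)
qed

lemma hodge_cmult: "\<star>(\<lambda>vs. r * \<alpha> vs) = (\<lambda>vs. r * (\<star>\<alpha>) vs)"
  by (simp add: hodge_def sum_distrib_left ac_simps)

lemma wedge_cmult:
  "((\<lambda>vs. r * \<alpha> vs) \<curlywedge> \<beta>) = (\<lambda>vs. r * (\<alpha> \<curlywedge> \<beta>) vs)"
  "(\<alpha> \<curlywedge> (\<lambda>vs. r * \<beta> vs)) = (\<lambda>vs. r * (\<alpha> \<curlywedge> \<beta>) vs)"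
  by (simp_all add: wedge_def sum_distrib_left ac_simps)

lemma contract_scale:
  "k_form k \<alpha> \<Longrightarrow> contract (r *\<^sub>R v) \<alpha> = (\<lambda>vs. r * contract v \<alpha> vs)"
  by (simp add: contract_def k_form_head_scale)

text \<open>Homogeneity suffices for the divergence, since the covariant derivatives of basis
  vectors are multiples of basis vectors.\<close>

lemma full_torsion_scale:
  assumes "torsion_forms br phi \<tau>0 \<tau>1 \<tau>2 \<tau>3"
  shows "full_torsion br phi (r *\<^sub>R v) w = r * full_torsion br phi v w"
    and "full_torsion br phi v (r *\<^sub>R w) = r * full_torsion br phi v w"
proof -
  have \<tau>: "k_form 1 \<tau>1" "k_form 2 \<tau>2" using assms by (auto simp: torsion_forms_def)
  define \<sigma> where "\<sigma> = \<star>(\<tau>1 \<curlywedge> \<star>phi)"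
  have \<sigma>: "k_form 2 \<sigma>"
    using k_form_hodge[OF k_form_wedge[OF \<tau>(1) k_form_star_phi]] by (simp add: \<sigma>_def)
  have *: "\<rho> [r *\<^sub>R v, w] = r * \<rho> [v, w]" "\<rho> [v, r *\<^sub>R w] = r * \<rho> [v, w]" if "k_form 2 \<rho>" for \<rho>
    using k_form_head_scale(1)[OF that] k_form_head_scale(1)[OF k_form_contract[OF that, of v]]
    by (simp_all add: contract_apply)
  have j: "j_map phi \<tau>3 (r *\<^sub>R v) w = r * j_map phi \<tau>3 v w"
    "j_map phi \<tau>3 v (r *\<^sub>R w) = r * j_map phi \<tau>3 v w"
    by (simp_all only: j_map_def contract_scale[OF k_form_phi] wedge_cmult hodge_cmult)
  note eq = full_torsion_eq[OF assms, folded \<sigma>_def]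
  show "full_torsion br phi (r *\<^sub>R v) w = r * full_torsion br phi v w"
    "full_torsion br phi v (r *\<^sub>R w) = r * full_torsion br phi v w"
    unfolding eq j *[OF \<tau>(2)] *[OF \<sigma>] inner_scaleR_left inner_scaleR_right
    by (simp_all add: algebra_simps)
qed

text \<open>The conceptual reason is parity: changing the signs of e_4, ..., e_7 preserves
  \<open>phi\<close>, \<open>vol\<close> and all torsion forms, hence the tensor, but negates these
  entries. The proof evaluates the four summands directly.\<close>

lemma full_torsion_g_eq_0:
  assumes "i \<in> {1, 2}" "k \<in> {4, 5, 6, 7}"
  shows "full_torsion (g_bracket a b c d) phi (e_vec i) (e_vec k) = 0"
proof -
  note [simp] = k_form_g_tau(2)[of c d] k_form_g_tau(3)[of a b c d] k_form_g_tau(1)[of c d, unfolded One_nat_def]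
    hodge_eval wedge_eval phi_basis k_form_phi
  have zero: "(\<star>(g_tau1 c d \<curlywedge> \<star>phi)) [e_vec i, e_vec k] = 0"
    using assms by (elim insertE emptyE; simp; simp add: g_tau_eval)
  have zero': "g_tau2 c d [e_vec i, e_vec k] = 0"
    using assms by (elim insertE emptyE; simp add: g_tau_eval)
  have zero'': "j_map phi (g_tau3 a b c d) (e_vec i) (e_vec k) = 0"
    unfolding j_map_def using assms by (elim insertE emptyE; simp; simp add: g_tau_eval)
  have inner: "e_vec i \<bullet> e_vec k = 0"
    using assms by (elim insertE emptyE; simp add: inner_vec7)
  show ?thesis
    by (simp only: full_torsion_eq[OF torsion_forms_g] zero zero' zero'' inner mult_zero_right diff_0_right)
qed

theorem theorem4p8:
  fixes a b c d :: real
  assumes "a^2 + c^2 \<noteq> 0" and "b^2 + d^2 \<noteq> 0" and "a * d - b * c \<noteq> 0"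
  shows "divergence (g_bracket a b c d) (full_torsion (g_bracket a b c d) phi) = 0"
proof -
  let ?T = "full_torsion (g_bracket a b c d) phi"
  have T0: "?T 0 w = 0" "?T v 0 = 0" for v w
    using full_torsion_scale[OF torsion_forms_g[of a b c d], where r = 0] by simp_all
  \<comment> \<open>Every summand vanishes separately: its first term contains the derivative of e_i
    along itself, and its second is 0 or a multiple of an entry covered by
    \<open>full_torsion_g_eq_0\<close>.\<close>
  have "cov_deriv (g_bracket a b c d) ?T (e_vec i) (e_vec i) (e_vec j) = 0"
    if "i \<in> {1..7}" "j \<in> {1..7}" for i j
  proof (rule levi_civita_g_basis[OF that, of a b c d])
    assume "levi_civita (g_bracket a b c d) (e_vec i) (e_vec j) = 0"
    then show ?thesis
      by (simp add: cov_deriv_def levi_civita_g_diag[OF that(1)] T0)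
  next
    fix r k assume "i \<in> {1, 2}" "k \<in> {4, 5, 6, 7}"
      "levi_civita (g_bracket a b c d) (e_vec i) (e_vec j) = r *\<^sub>R e_vec k"
    then show ?thesis
      by (simp add: cov_deriv_def levi_civita_g_diag[OF that(1)] T0
          full_torsion_scale[OF torsion_forms_g] full_torsion_g_eq_0)
  qed
  then show ?thesis by (simp add: divergence_def)
qed

end
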